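(* For every integer $r\ge 2$, $\mathrm{egd}(F_r)=r$. Moreover, $F_r$ is a minimal forbidden minor for the class $\mathcal{G}_{r-1}$.
   Context: All graphs are finite and simple. Notation: $[n]=\{1,\dots,n\}$; $X\succeq 0$ means $X$ is a real symmetric positive semidefinite matrix. Extreme Gram dimension: for a graph $G=([n],E)$, $\mathrm{egd}(G)$ is the smallest integer $r\ge 1$ such that for every $w\in\mathbb{R}^E$ the semidefinite program $\max\ \sum_{ij\in E}w_{ij}X_{ij}$ subject to $X_{ii}=1$ $(i\in[n])$, $X\succeq 0$ ($X$ an $n\times n$ symmetric matrix) has an optimal solution of rank at most $r$. For an integer $r\ge 1$, $\mathcal{G}_r$ is the class of graphs $G$ with $\mathrm{egd}(G)\le r$; it is closed under taking minors. A graph is a minimal forbidden minor for a minor-closed class if it does not belong to the class but all its proper minors do (minors are obtained by edge deletions, edge contractions and node deletions). For $r\ge 2$ the graph $F_r$ has $\binom{r+1}{2}$ nodes, denoted $v_i$ ($i\in[r]$) and $v_{ij}$ ($1\le i<j\le r$); it consists of a clique $K_r$ on $\{v_1,\dots,v_r\}$ together with the triangles (3-cliques) on $\{v_i,v_j,v_{ij}\}$ for all $1\le i<j\le r$. *)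

theory Defs
  imports Complex_Main "HOL-Library.Function_Algebras"
begin

text \<open>A graph is a pair (V, E) of a vertex set and a set of edges, each edge a two-element
  subset of V.\<close>

type_synonym 'a graph = "'a set \<times> 'a set set"

definition simple_graph :: "'a graph \<Rightarrow> bool" where
  "simple_graph G \<longleftrightarrow>
     finite (fst G) \<and> (\<forall>e\<in>snd G. e \<subseteq> fst G \<and> card e = 2)"

definition delete_edge :: "'a set \<Rightarrow> 'a graph \<Rightarrow> 'a graph" where
  "delete_edge e G = (fst G, snd G - {e})"

definition delete_node :: "'a \<Rightarrow> 'a graph \<Rightarrow> 'a graph" where
  "delete_node v G = (fst G - {v}, {e \<in> snd G. v \<notin> e})"

text \<open>Contraction of the edge {u, v}: the merged node keeps the name u. Parallel edges are
  identified because the edges form a set, and {u, v} itself, the only edge that would become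
  a loop, is removed.\<close>

definition contract_edge :: "'a \<Rightarrow> 'a \<Rightarrow> 'a graph \<Rightarrow> 'a graph" where
  "contract_edge u v G =
     (fst G - {v}, (\<lambda>e. (id(v := u)) ` e) ` (snd G - {{u, v}}))"

inductive minor_step :: "'a graph \<Rightarrow> 'a graph \<Rightarrow> bool" where
  edge_deletion: "e \<in> snd G \<Longrightarrow> minor_step G (delete_edge e G)"
| edge_contraction: "{u, v} \<in> snd G \<Longrightarrow> minor_step G (contract_edge u v G)"
| node_deletion: "v \<in> fst G \<Longrightarrow> minor_step G (delete_node v G)"

definition proper_minor :: "'a graph \<Rightarrow> 'a graph \<Rightarrow> bool" where
  "proper_minor H G \<longleftrightarrow> minor_step\<^sup>+\<^sup>+ G H"

definition minimal_forbidden_minor :: "'a graph \<Rightarrow> 'a graph set \<Rightarrow> bool" where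
  "minimal_forbidden_minor G \<C> \<longleftrightarrow>
     simple_graph G \<and> G \<notin> \<C> \<and> (\<forall>H. proper_minor H G \<longrightarrow> H \<in> \<C>)"

text \<open>A real matrix with rows and columns indexed by the finite set V is a function
  X :: 'a => 'a => real of which only the values on V x V are used.\<close>

definition psd_on :: "'a set \<Rightarrow> ('a \<Rightarrow> 'a \<Rightarrow> real) \<Rightarrow> bool" where
  "psd_on V X \<longleftrightarrow>
     (\<forall>i\<in>V. \<forall>j\<in>V. X i j = X j i) \<and>
     (\<forall>x. (\<Sum>i\<in>V. \<Sum>j\<in>V. x i * X i j * x j) \<ge> 0)"

definition fun_scale :: "real \<Rightarrow> ('a \<Rightarrow> real) \<Rightarrow> 'a \<Rightarrow> real" where
  "fun_scale c f = (\<lambda>i. c * f i)"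

interpretation fun_vs: vector_space "fun_scale :: real \<Rightarrow> ('a \<Rightarrow> real) \<Rightarrow> 'a \<Rightarrow> real"
  by unfold_locales (auto simp: fun_scale_def fun_eq_iff algebra_simps)

text \<open>The rank is the dimension of the column space. Columns are extended by zero outside V,
  so that they live in the vector space of all functions 'a => real.\<close>

definition rank_on :: "'a set \<Rightarrow> ('a \<Rightarrow> 'a \<Rightarrow> real) \<Rightarrow> nat" where
  "rank_on V X = fun_vs.dim ((\<lambda>j i. if i \<in> V then X i j else 0) ` V)"

definition sdp_feasible :: "'a graph \<Rightarrow> ('a \<Rightarrow> 'a \<Rightarrow> real) \<Rightarrow> bool" where
  "sdp_feasible G X \<longleftrightarrow> psd_on (fst G) X \<and> (\<forall>i\<in>fst G. X i i = 1)"

text \<open>The factor 1/2 compensates for each edge {i, j} being visited as (i, j) and as (j, i);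
  for symmetric X the value is the sum of w e * X i j over the edges e = {i, j}.\<close>

definition sdp_objective :: "'a graph \<Rightarrow> ('a set \<Rightarrow> real) \<Rightarrow> ('a \<Rightarrow> 'a \<Rightarrow> real) \<Rightarrow> real" where
  "sdp_objective G w X =
     (\<Sum>i\<in>fst G. \<Sum>j\<in>fst G. if {i, j} \<in> snd G then w {i, j} * X i j else 0) / 2"

definition sdp_optimal :: "'a graph \<Rightarrow> ('a set \<Rightarrow> real) \<Rightarrow> ('a \<Rightarrow> 'a \<Rightarrow> real) \<Rightarrow> bool" where
  "sdp_optimal G w X \<longleftrightarrow>
     sdp_feasible G X \<and>
     (\<forall>Y. sdp_feasible G Y \<longrightarrow> sdp_objective G w Y \<le> sdp_objective G w X)"

text \<open>For a finite graph the set below is nonempty: an optimal solution always exists by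
  compactness, and its rank is at most the number of nodes. So LEAST is a genuine minimum.\<close>

definition egd :: "'a graph \<Rightarrow> nat" where
  "egd G = (LEAST r. r \<ge> 1 \<and> (\<forall>w. \<exists>X. sdp_optimal G w X \<and> rank_on (fst G) X \<le> r))"

definition egd_class :: "nat \<Rightarrow> 'a graph set" where
  "egd_class r = {G. simple_graph G \<and> egd G \<le> r}"

text \<open>Vert i stands for the node v_i, and Apex i j (with i < j) for the node v_ij.\<close>

datatype fnode = Vert nat | Apex nat nat

definition F_graph :: "nat \<Rightarrow> fnode graph" where
  "F_graph r =
     (Vert ` {1..r} \<union> {Apex i j | i j. 1 \<le> i \<and> i < j \<and> j \<le> r},
      \<Union>{{{Vert i, Vert j}, {Vert i, Apex i j}, {Vert j, Apex i j}} | i j.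
          1 \<le> i \<and> i < j \<and> j \<le> r})"

end

theory Submission
  imports Defs "HOL-Analysis.Function_Topology"
begin

text \<open>A feasible matrix is the Gram matrix of unit vectors, one for each node. Let \<open>C\<close> be a
  vertex cover. A node outside \<open>C\<close> only sees vectors of \<open>C\<close>, and its best position is the
  normalised weighted sum of these, which lies in their span. So some optimal solution has rank at
  most \<open>card C\<close>. The clique of $F_r$ is a vertex cover with \<open>r\<close> nodes, hence
  $\mathrm{egd}(F_r) \le r$.

  For the lower bound each triangle gets weights under which its contribution to the objective is
  at most 2, with equality only if the two clique vectors are orthogonal. Orthonormal clique
  vectors attain all these bounds simultaneously, so the clique vectors of every optimal solution
  are orthonormal and its rank is at least \<open>r\<close> (\<open>rank_on_F_optimal_ge\<close>).

  For minimality, one dimension has to be saved by every minor operation. With the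
  positions outside \<open>C\<close> optimised, the objective is a sum of terms that depend on the inner
  products within \<open>C\<close> alone. If nodes \<open>s\<close>, \<open>t\<close> of \<open>C\<close> interact in only
  one way, by an edge or by a single common neighbour outside \<open>C\<close>, then the objective is
  monotone in their inner product. The vector of \<open>t\<close> can then be rotated, keeping all its
  other inner products, until it falls into the span of the remaining vectors of \<open>C\<close>, without
  lowering the objective (\<open>low_rank_optimum_of_free_pair\<close>). This sufficient condition for
  rank \<open>card C - 1\<close> is purely combinatorial and survives all minor operations
  (\<open>low_cover_minor_step\<close>). In $F_r$ two clique nodes interact in exactly two ways, and deleting any edge
  destroys one of them. Finally, every edge of $F_r$ lies in a triangle, which makes every proper
  minor a minor of some edge deletion (\<open>low_cover_proper_minor\<close>).\<close>

section \<open>The semi-inner product of a positive semidefinite matrix\<close>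

text \<open>Functions on the nodes are read as formal linear combinations of the vectors behind
  \<open>X\<close>, with \<open>unit_at i\<close> in the role of the vector of node \<open>i\<close>. In this way \<open>X\<close>
  itself supplies the geometry, and no factorisation of \<open>X\<close> has to be constructed.\<close>

definition gram_form :: "'a set \<Rightarrow> ('a \<Rightarrow> 'a \<Rightarrow> real) \<Rightarrow> ('a \<Rightarrow> real) \<Rightarrow> ('a \<Rightarrow> real) \<Rightarrow> real" where
  "gram_form V X f g = (\<Sum>i\<in>V. \<Sum>j\<in>V. f i * X i j * g j)"

definition unit_at :: "'a \<Rightarrow> 'a \<Rightarrow> real" where
  "unit_at i = (\<lambda>k. if k = i then 1 else 0)"

lemma gram_form_sum_left:
  "gram_form V X (\<lambda>x. \<Sum>k\<in>K. c k * F k x) g = (\<Sum>k\<in>K. c k * gram_form V X (F k) g)"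
proof -
  have "gram_form V X (\<lambda>x. \<Sum>k\<in>K. c k * F k x) g =
      (\<Sum>i\<in>V. \<Sum>j\<in>V. \<Sum>k\<in>K. c k * (F k i * X i j * g j))"
    unfolding gram_form_def by (simp add: sum_distrib_right mult.assoc)
  also have "\<dots> = (\<Sum>i\<in>V. \<Sum>k\<in>K. \<Sum>j\<in>V. c k * (F k i * X i j * g j))"
    by (intro sum.cong refl sum.swap)
  also have "\<dots> = (\<Sum>k\<in>K. \<Sum>i\<in>V. \<Sum>j\<in>V. c k * (F k i * X i j * g j))"
    by (rule sum.swap)
  finally show ?thesis
    by (simp add: gram_form_def sum_distrib_left)
qed

lemma gram_form_add_scaled_left:
  "gram_form V X (\<lambda>x. f x + c * g x) h = gram_form V X f h + c * gram_form V X g h"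
  unfolding gram_form_def
  by (simp add: algebra_simps sum.distrib sum_distrib_left)

lemma gram_form_scaled_left:
  "gram_form V X (\<lambda>x. c * g x) h = c * gram_form V X g h"
  unfolding gram_form_def
  by (simp add: algebra_simps sum_distrib_left)

lemma gram_form_unit_left:
  assumes "finite V" "i \<in> V"
  shows "gram_form V X (unit_at i) g = (\<Sum>j\<in>V. X i j * g j)"
proof -
  have "gram_form V X (unit_at i) g = (\<Sum>k\<in>V. if k = i then (\<Sum>j\<in>V. X k j * g j) else 0)"
    unfolding gram_form_def by (intro sum.cong) (auto simp: unit_at_def)
  then show ?thesis using assms by simp
qed

lemma gram_form_units:
  assumes "finite V" "i \<in> V" "j \<in> V"
  shows "gram_form V X (unit_at i) (unit_at j) = X i j"
proof -
  have "(\<Sum>k\<in>V. X i k * unit_at j k) = (\<Sum>k\<in>V. if k = j then X i k else 0)"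
    by (intro sum.cong) (auto simp: unit_at_def)
  then show ?thesis using assms by (simp add: gram_form_unit_left)
qed

lemma gram_form_sym:
  assumes "psd_on V X"
  shows "gram_form V X f g = gram_form V X g f"
proof -
  have "gram_form V X f g = (\<Sum>j\<in>V. \<Sum>i\<in>V. f i * X i j * g j)"
    unfolding gram_form_def by (rule sum.swap)
  also have "\<dots> = gram_form V X g f"
    unfolding gram_form_def using assms
    by (intro sum.cong refl) (auto simp: psd_on_def)
  finally show ?thesis .
qed

lemma gram_form_nonneg: "psd_on V X \<Longrightarrow> gram_form V X f f \<ge> 0"
  by (simp add: psd_on_def gram_form_def)

lemma gram_form_sum_right:
  assumes "psd_on V X"
  shows "gram_form V X g (\<lambda>x. \<Sum>k\<in>K. c k * F k x) = (\<Sum>k\<in>K. c k * gram_form V X g (F k))"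
  using gram_form_sum_left[of V X c F K g] gram_form_sym[OF assms] by simp

lemma gram_form_add_scaled_right:
  assumes "psd_on V X"
  shows "gram_form V X h (\<lambda>x. f x + c * g x) = gram_form V X h f + c * gram_form V X h g"
  using gram_form_add_scaled_left[of V X f c g h] gram_form_sym[OF assms] by simp

lemma gram_form_scaled_right:
  assumes "psd_on V X"
  shows "gram_form V X h (\<lambda>x. c * g x) = c * gram_form V X h g"
  using gram_form_scaled_left[of V X c g h] gram_form_sym[OF assms] by simp

lemma gram_form_Cauchy_Schwarz:
  assumes "psd_on V X"
  shows "(gram_form V X f g)\<^sup>2 \<le> gram_form V X f f * gram_form V X g g"
proof -
  let ?a = "gram_form V X f f" and ?b = "gram_form V X f g" and ?c = "gram_form V X g g"
  have q: "0 \<le> ?c + 2 * t * ?b + t\<^sup>2 * ?a" for t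
  proof -
    have "0 \<le> gram_form V X (\<lambda>x. g x + t * f x) (\<lambda>x. g x + t * f x)"
      by (rule gram_form_nonneg[OF assms])
    also have "\<dots> = ?c + 2 * t * ?b + t\<^sup>2 * ?a"
      using gram_form_sym[OF assms, of g f]
      by (simp add: gram_form_add_scaled_left gram_form_add_scaled_right[OF assms]
          algebra_simps power2_eq_square)
    finally show ?thesis .
  qed
  show ?thesis
  proof (cases "?a = 0")
    case True
    have "?b = 0"
    proof (rule ccontr)
      assume b: "?b \<noteq> 0"
      have "0 \<le> ?c + 2 * (- (?c + 1) / (2 * ?b)) * ?b"
        using q[of "- (?c + 1) / (2 * ?b)"] True by simp
      also have "\<dots> = - 1" using b by (simp add: field_simps)
      finally show False by simp
    qed
    then show ?thesis using True by simp
  next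
    case False
    then have a: "?a > 0" using gram_form_nonneg[OF assms, of f] by simp
    have "0 \<le> ?c + 2 * (- ?b / ?a) * ?b + (- ?b / ?a)\<^sup>2 * ?a" by (rule q)
    also have "\<dots> = ?c - ?b\<^sup>2 / ?a"
      using a by (simp add: field_simps power2_eq_square)
    finally show ?thesis using a by (simp add: field_simps)
  qed
qed

lemma gram_form_null:
  assumes "psd_on V X" "gram_form V X f f = 0"
  shows "gram_form V X f g = 0"
  using gram_form_Cauchy_Schwarz[OF assms(1), of f g] assms(2) by simp

lemma gram_form_diff_left:
  "gram_form V X (\<lambda>x. f x - g x) h = gram_form V X f h - gram_form V X g h"
  using gram_form_add_scaled_left[of V X f "-1" g h] by simp

lemma expand_in_units:
  assumes "finite D" "\<And>x. x \<notin> D \<Longrightarrow> f x = 0"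
  shows "f = (\<lambda>x. \<Sum>d\<in>D. f d * unit_at d x)"
proof
  fix x
  have "(\<Sum>d\<in>D. f d * unit_at d x) = (\<Sum>d\<in>D. if x = d then f d else 0)"
    by (intro sum.cong) (auto simp: unit_at_def)
  then show "f x = (\<Sum>d\<in>D. f d * unit_at d x)" using assms by auto
qed

lemma gram_form_orthogonal_supported:
  assumes "psd_on V X" "finite D" "\<And>d. d \<in> D \<Longrightarrow> gram_form V X h (unit_at d) = 0"
    and "\<And>x. x \<notin> D \<Longrightarrow> f x = 0"
  shows "gram_form V X h f = 0"
  by (subst expand_in_units[OF assms(2,4)])
     (simp_all add: gram_form_sum_right[OF assms(1)] assms(3))

text \<open>Gram--Schmidt, run by induction on \<open>D\<close>. The form may be degenerate: a new basis
  vector whose residual is null is already orthogonal to everything and needs no correction.\<close>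

lemma gram_form_projection:
  assumes "psd_on V X" "finite D"
  shows "\<exists>\<pi>. (\<forall>x. x \<notin> D \<longrightarrow> \<pi> x = 0) \<and>
             (\<forall>d\<in>D. gram_form V X (\<lambda>x. f x - \<pi> x) (unit_at d) = 0)"
  using assms(2)
proof (induction D arbitrary: f)
  case empty
  show ?case by (intro exI[of _ "\<lambda>_. 0"]) auto
next
  case (insert e D)
  let ?B = "gram_form V X"
  obtain \<pi> where \<pi>: "\<And>x. x \<notin> D \<Longrightarrow> \<pi> x = 0"
      "\<And>d. d \<in> D \<Longrightarrow> ?B (\<lambda>x. f x - \<pi> x) (unit_at d) = 0"
    using insert.IH[of f] by auto
  obtain \<sigma> where \<sigma>: "\<And>x. x \<notin> D \<Longrightarrow> \<sigma> x = 0"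
      "\<And>d. d \<in> D \<Longrightarrow> ?B (\<lambda>x. unit_at e x - \<sigma> x) (unit_at d) = 0"
    using insert.IH[of "unit_at e"] by auto
  define \<xi> where "\<xi> = (\<lambda>x. f x - \<pi> x)"
  define \<rho> where "\<rho> = (\<lambda>x. unit_at e x - \<sigma> x)"
  define c where "c = ?B \<xi> \<rho> / ?B \<rho> \<rho>"
  define \<tau> where "\<tau> = (\<lambda>x. \<pi> x + c * \<rho> x)"
  have res: "(\<lambda>x. f x - \<tau> x) = (\<lambda>x. \<xi> x + (- c) * \<rho> x)"
    by (auto simp: \<tau>_def \<xi>_def)
  have supp: "\<tau> x = 0" if "x \<notin> insert e D" for x
    using that \<pi>(1) \<sigma>(1) by (auto simp: \<tau>_def \<rho>_def unit_at_def)
  have onD: "?B (\<lambda>x. f x - \<tau> x) (unit_at d) = 0" if "d \<in> D" for d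
    using \<pi>(2)[OF that] \<sigma>(2)[OF that]
    unfolding res gram_form_add_scaled_left by (simp add: \<xi>_def \<rho>_def)
  have "?B (\<lambda>x. f x - \<tau> x) \<rho> = ?B \<xi> \<rho> - c * ?B \<rho> \<rho>"
    unfolding res gram_form_add_scaled_left by simp
  also have "\<dots> = 0"
  proof (cases "?B \<rho> \<rho> = 0")
    case True
    then have "?B \<xi> \<rho> = 0"
      using gram_form_null[OF assms(1) True, of \<xi>] gram_form_sym[OF assms(1)] by metis
    then show ?thesis using True by simp
  qed (simp add: c_def)
  finally have r0: "?B (\<lambda>x. f x - \<tau> x) \<rho> = 0" .
  have s0: "?B (\<lambda>x. f x - \<tau> x) \<sigma> = 0"
    by (rule gram_form_orthogonal_supported[OF assms(1) insert.hyps(1) onD \<sigma>(1)])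
  have "(\<lambda>x. \<rho> x + 1 * \<sigma> x) = unit_at e" by (auto simp: \<rho>_def)
  then have "?B (\<lambda>x. f x - \<tau> x) (unit_at e) = 0"
    using gram_form_add_scaled_right[OF assms(1), of "\<lambda>x. f x - \<tau> x" \<rho> 1 \<sigma>] r0 s0 by simp
  then show ?case using supp onD by (intro exI[of _ \<tau>]) auto
qed

section \<open>Feasible matrices, rank and the existence of optimal solutions\<close>

lemma sdp_feasible_entry_bound:
  assumes "finite (fst G)" "sdp_feasible G X" "i \<in> fst G" "j \<in> fst G"
  shows "\<bar>X i j\<bar> \<le> 1"
proof -
  have psd: "psd_on (fst G) X" and diag: "X i i = 1" "X j j = 1"
    using assms by (auto simp: sdp_feasible_def)
  have "(X i j)\<^sup>2 \<le> 1"
    using gram_form_Cauchy_Schwarz[OF psd, of "unit_at i" "unit_at j"] diag assms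
    by (simp add: gram_form_units)
  then show ?thesis by (simp add: abs_square_le_1)
qed

lemma psd_on_unit_gram:
  assumes "finite V"
  shows "psd_on V (\<lambda>i j. if i = j then 1 else 0)"
proof -
  have "(\<Sum>i\<in>V. \<Sum>j\<in>V. x i * (if i = j then 1 else 0) * x j) = (\<Sum>i\<in>V. x i * x i)" for x :: "'a \<Rightarrow> real"
  proof (intro sum.cong refl)
    fix i assume "i \<in> V"
    have "(\<Sum>j\<in>V. x i * (if i = j then 1 else 0) * x j) = (\<Sum>j\<in>V. if i = j then x i * x j else 0)"
      by (intro sum.cong) auto
    then show "(\<Sum>j\<in>V. x i * (if i = j then 1 else 0) * x j) = x i * x i"
      using assms \<open>i \<in> V\<close> by simp
  qed
  then show ?thesis by (auto simp: psd_on_def intro!: sum_nonneg)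
qed

text \<open>The feasible matrices form a compact set: their entries lie in \<open>[-1, 1]\<close>, and
  positive semidefiniteness is a closed condition on finitely many entries.\<close>

lemma sdp_optimal_exists:
  assumes "finite (fst G)"
  shows "\<exists>X. sdp_optimal G w X"
proof -
  let ?V = "fst G"
  define Box :: "('a \<times> 'a \<Rightarrow> real) set" where "Box = PiE UNIV (\<lambda>_. {-1..1})"
  define S where "S = Box \<inter> {Z. sdp_feasible G (curry Z)}"
  have "compact Box"
  proof -
    have "compactin (product_topology (\<lambda>_. euclidean) UNIV) Box"
      unfolding Box_def by (subst compactin_PiE) auto
    then show ?thesis by (simp add: euclidean_product_topology)
  qed
  moreover have "closed {Z. sdp_feasible G (curry Z)}"
  proof -
    have "{Z. sdp_feasible G (curry Z)} =
        (\<Inter>i\<in>?V. \<Inter>j\<in>?V. {Z. Z (i, j) = Z (j, i)}) \<inter>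
        (\<Inter>x. {Z. 0 \<le> (\<Sum>i\<in>?V. \<Sum>j\<in>?V. x i * Z (i, j) * x j)}) \<inter>
        (\<Inter>i\<in>?V. {Z. Z (i, i) = 1})"
      by (auto simp: sdp_feasible_def psd_on_def)
    moreover have "closed \<dots>"
      by (intro closed_Int closed_INT ballI closed_Collect_eq closed_Collect_le
          continuous_intros continuous_on_product_coordinates)
    ultimately show ?thesis by simp
  qed
  ultimately have compact: "compact S" unfolding S_def by (rule compact_Int_closed)
  have "(\<lambda>(i, j). if i = j then 1 else 0) \<in> S"
    using psd_on_unit_gram[OF assms]
    by (auto simp: S_def Box_def sdp_feasible_def curry_def)
  then have nonempty: "S \<noteq> {}" by blast
  have "continuous_on S (\<lambda>Z. sdp_objective G w (curry Z))"
    unfolding sdp_objective_def curry_def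
  proof (intro continuous_intros)
    fix i j
    show "continuous_on S (\<lambda>Z. if {i, j} \<in> snd G then w {i, j} * Z (i, j) else 0)"
      by (cases "{i, j} \<in> snd G")
         (auto intro!: continuous_on_mult_left continuous_on_subset[OF continuous_on_product_coordinates])
  qed simp
  then obtain Z where Z: "Z \<in> S"
      "\<And>Z'. Z' \<in> S \<Longrightarrow> sdp_objective G w (curry Z') \<le> sdp_objective G w (curry Z)"
    using continuous_attains_sup[OF compact nonempty] by blast
  have "sdp_objective G w Y \<le> sdp_objective G w (curry Z)" if Y: "sdp_feasible G Y" for Y
  proof -
    \<comment> \<open>Entries of \<open>Y\<close> outside \<open>V \<times> V\<close> are arbitrary; zero brings them into the box.\<close>
    define Z' where "Z' = (\<lambda>(i, j). if i \<in> ?V \<and> j \<in> ?V then Y i j else 0)"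
    have "psd_on ?V (curry Z') = psd_on ?V Y"
      by (simp add: psd_on_def Z'_def cong: ball_cong sum.cong)
    then have "sdp_feasible G (curry Z')"
      using Y by (simp add: sdp_feasible_def Z'_def)
    moreover have "Z' \<in> Box"
      using sdp_feasible_entry_bound[OF assms Y] by (auto simp: Box_def Z'_def abs_le_iff minus_le_iff)
    ultimately have "sdp_objective G w (curry Z') \<le> sdp_objective G w (curry Z)"
      using Z(2) by (simp add: S_def)
    moreover have "sdp_objective G w (curry Z') = sdp_objective G w Y"
      by (auto simp: sdp_objective_def Z'_def intro!: sum.cong)
    ultimately show ?thesis by simp
  qed
  then show ?thesis using Z(1) by (auto simp: sdp_optimal_def S_def)
qed

lemma psd_on_gram_matrix:
  assumes "psd_on V X" "finite U"
  shows "psd_on U (\<lambda>i j. gram_form V X (L i) (L j))"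
  unfolding psd_on_def
proof (intro conjI ballI allI)
  fix x :: "'b \<Rightarrow> real"
  have "(\<Sum>i\<in>U. \<Sum>j\<in>U. x i * gram_form V X (L i) (L j) * x j) =
      gram_form V X (\<lambda>k. \<Sum>i\<in>U. x i * L i k) (\<lambda>k. \<Sum>i\<in>U. x i * L i k)"
    by (simp add: gram_form_sum_left gram_form_sum_right[OF assms(1)] sum_distrib_left mult_ac)
  then show "0 \<le> (\<Sum>i\<in>U. \<Sum>j\<in>U. x i * gram_form V X (L i) (L j) * x j)"
    using gram_form_nonneg[OF assms(1)] by simp
qed (rule gram_form_sym[OF assms(1)])

lemma sum_functions_at: "(\<Sum>k\<in>K. F k) x = (\<Sum>k\<in>K. F k x)"
  for F :: "'k \<Rightarrow> 'b \<Rightarrow> real"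
  by (induction K rule: infinite_finite_induct) auto

text \<open>Column \<open>j\<close> of such a Gram matrix is linear in \<open>L j\<close>, so the columns are
  combinations of the \<open>card D\<close> functions obtained from the basis vectors at \<open>D\<close>.\<close>

lemma rank_on_gram_matrix_le:
  assumes "psd_on V X" "finite D" "\<And>j x. j \<in> U \<Longrightarrow> x \<notin> D \<Longrightarrow> L j x = 0"
  shows "rank_on U (\<lambda>i j. gram_form V X (L i) (L j)) \<le> card D"
proof -
  define col where "col = (\<lambda>d i. if i \<in> U then gram_form V X (L i) (unit_at d) else 0)"
  have "(\<lambda>i. if i \<in> U then gram_form V X (L i) (L j) else 0) \<in> fun_vs.span (col ` D)"
    if "j \<in> U" for j
  proof -
    have "gram_form V X (L i) (L j) = (\<Sum>d\<in>D. L j d * gram_form V X (L i) (unit_at d))" for i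
      by (subst expand_in_units[OF assms(2), of "L j", OF assms(3)[OF that]])
         (simp_all add: gram_form_sum_right[OF assms(1)])
    then have "(\<lambda>i. if i \<in> U then gram_form V X (L i) (L j) else 0) =
        (\<Sum>d\<in>D. fun_scale (L j d) (col d))"
      by (auto simp: fun_eq_iff fun_scale_def col_def sum_functions_at)
    also have "\<dots> \<in> fun_vs.span (col ` D)"
      by (intro fun_vs.span_sum fun_vs.span_scale fun_vs.span_base) auto
    finally show ?thesis .
  qed
  then have "rank_on U (\<lambda>i j. gram_form V X (L i) (L j)) \<le> card (col ` D)"
    unfolding rank_on_def using assms(2) by (intro fun_vs.dim_le_card) auto
  also have "\<dots> \<le> card D" by (rule card_image_le[OF assms(2)])
  finally show ?thesis .
qed

text \<open>Columns on an orthonormal set of nodes are linearly independent: evaluating a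
  combination at one of these nodes isolates its coefficient.\<close>

lemma rank_on_ge_orthonormal:
  assumes "finite V" "K \<subseteq> V" "\<And>i j. i \<in> K \<Longrightarrow> j \<in> K \<Longrightarrow> X i j = (if i = j then 1 else 0)"
  shows "card K \<le> rank_on V X"
proof -
  define col where "col = (\<lambda>j i. if i \<in> V then X i j else 0)"
  have finK: "finite K" using assms(1,2) finite_subset by blast
  have at: "col j i = (if i = j then 1 else 0)" if "i \<in> K" "j \<in> K" for i j
    using that assms(2,3) by (auto simp: col_def)
  have inj: "inj_on col K"
  proof (rule inj_onI)
    fix i j assume "i \<in> K" "j \<in> K" "col i = col j"
    then show "i = j" using at[of i i] at[of i j] by (auto split: if_splits)
  qed
  have "fun_vs.independent (col ` K)"
  proof (rule fun_vs.independent_if_scalars_zero)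
    show "finite (col ` K)" using finK by simp
  next
    fix f v assume s: "(\<Sum>x\<in>col ` K. fun_scale (f x) x) = 0" and "v \<in> col ` K"
    then obtain i where i: "i \<in> K" "v = col i" by blast
    have "0 = (\<Sum>x\<in>col ` K. fun_scale (f x) x) i" using s by simp
    also have "\<dots> = (\<Sum>j\<in>K. f (col j) * col j i)"
      by (simp add: sum.reindex[OF inj] sum_functions_at fun_scale_def)
    also have "\<dots> = (\<Sum>j\<in>K. if i = j then f (col j) else 0)"
      using i(1) at by (intro sum.cong) auto
    also have "\<dots> = f v" using i finK by simp
    finally show "f v = 0" by simp
  qed
  moreover obtain B where B: "B \<subseteq> col ` V" "col ` V \<subseteq> fun_vs.span B"
      "card B = fun_vs.dim (col ` V)"
    using fun_vs.basis_exists by metis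
  moreover have "finite B" using B(1) assms(1) finite_subset by blast
  ultimately have "card (col ` K) \<le> fun_vs.dim (col ` V)"
    using fun_vs.independent_span_bound[of B "col ` K"] assms(2) by auto
  then show ?thesis
    using card_image[OF inj] by (simp add: rank_on_def col_def)
qed

section \<open>Optimal solutions carried by a vertex cover\<close>

definition vertex_cover :: "'a graph \<Rightarrow> 'a set \<Rightarrow> bool" where
  "vertex_cover G C \<longleftrightarrow> C \<subseteq> fst G \<and> (\<forall>e\<in>snd G. e \<inter> C \<noteq> {})"

definition edge_weight :: "'a graph \<Rightarrow> ('a set \<Rightarrow> real) \<Rightarrow> 'a \<Rightarrow> 'a \<Rightarrow> real" where
  "edge_weight G w i j = (if {i, j} \<in> snd G then w {i, j} else 0)"

lemma edge_weight_sym: "edge_weight G w i j = edge_weight G w j i"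
  by (simp add: edge_weight_def insert_commute)

lemma sdp_objective_split:
  assumes "finite (fst G)" "vertex_cover G C" and sym: "\<And>i j. i \<in> fst G \<Longrightarrow> j \<in> fst G \<Longrightarrow> X i j = X j i"
  shows "sdp_objective G w X =
    (\<Sum>c\<in>C. \<Sum>d\<in>C. edge_weight G w c d * X c d) / 2 +
    (\<Sum>a\<in>fst G - C. \<Sum>c\<in>C. edge_weight G w a c * X a c)"
proof -
  let ?V = "fst G" and ?f = "\<lambda>i j. edge_weight G w i j * X i j"
  have C: "C \<subseteq> ?V" using assms(2) by (simp add: vertex_cover_def)
  have split: "sum h ?V = sum h C + sum h (?V - C)" for h :: "'a \<Rightarrow> real"
    using sum.subset_diff[OF C assms(1), of h] by simp
  have "(\<Sum>i\<in>?V. \<Sum>j\<in>?V. ?f i j) = (\<Sum>c\<in>C. \<Sum>d\<in>C. ?f c d) + (\<Sum>c\<in>C. \<Sum>a\<in>?V - C. ?f c a)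
      + (\<Sum>a\<in>?V - C. \<Sum>c\<in>C. ?f a c) + (\<Sum>a\<in>?V - C. \<Sum>b\<in>?V - C. ?f a b)"
    by (simp add: split sum.distrib)
  also have "(\<Sum>a\<in>?V - C. \<Sum>b\<in>?V - C. ?f a b) = 0"
    using assms(2) by (intro sum.neutral ballI) (auto simp: edge_weight_def vertex_cover_def)
  also have "(\<Sum>c\<in>C. \<Sum>a\<in>?V - C. ?f c a) = (\<Sum>a\<in>?V - C. \<Sum>c\<in>C. ?f c a)"
    by (rule sum.swap)
  also have "\<dots> = (\<Sum>a\<in>?V - C. \<Sum>c\<in>C. ?f a c)"
    using sym C by (intro sum.cong refl) (auto simp: edge_weight_sym)
  moreover have "sdp_objective G w X = (\<Sum>i\<in>?V. \<Sum>j\<in>?V. ?f i j) / 2"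
    unfolding sdp_objective_def edge_weight_def
    by (intro arg_cong[where f="\<lambda>x. x / 2"] sum.cong refl) auto
  ultimately show ?thesis by simp
qed

text \<open>The nodes outside a vertex cover \<open>C\<close> only see \<open>C\<close>. Once vectors \<open>y c\<close> for \<open>c \<in> C\<close>
  are fixed, the best choice for such a node \<open>a\<close> is the normalised vector
  \<open>\<Sum>c. W a c * y c\<close>, and its contribution to the objective is the norm of that sum. Hence the
  best value for given \<open>y\<close> is a function of the Gram matrix of \<open>y\<close>, it grows with
  the weighted inner products below, and the nodes outside \<open>C\<close> cost no further dimension.\<close>

lemma sdp_optimal_carried_by_cover:
  fixes G :: "'a graph" and w X
  defines "B \<equiv> gram_form (fst G) X" and "W \<equiv> edge_weight G w"
  assumes fin: "finite (fst G)" and cover: "vertex_cover G C" and opt: "sdp_optimal G w X"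
    and D: "D \<subseteq> fst G" "D \<noteq> {}"
    and supp: "\<And>c x. c \<in> C \<Longrightarrow> x \<notin> D \<Longrightarrow> y c x = 0"
    and unit: "\<And>c. c \<in> C \<Longrightarrow> B (y c) (y c) = 1"
    and core: "\<And>c d. c \<in> C \<Longrightarrow> d \<in> C \<Longrightarrow> W c d * X c d \<le> W c d * B (y c) (y d)"
    and outer: "\<And>a c d. a \<in> fst G - C \<Longrightarrow> c \<in> C \<Longrightarrow> d \<in> C \<Longrightarrow>
                  W a c * W a d * X c d \<le> W a c * W a d * B (y c) (y d)"
  shows "\<exists>Y. sdp_optimal G w Y \<and> rank_on (fst G) Y \<le> card D"
proof -
  let ?V = "fst G"
  have psd: "psd_on ?V X" and diag: "\<And>i. i \<in> ?V \<Longrightarrow> X i i = 1"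
    using opt by (auto simp: sdp_optimal_def sdp_feasible_def)
  have C: "C \<subseteq> ?V" using cover by (simp add: vertex_cover_def)
  have finD: "finite D" using fin D finite_subset by blast
  have X_B: "X i j = B (unit_at i) (unit_at j)" if "i \<in> ?V" "j \<in> ?V" for i j
    using that fin by (simp add: B_def gram_form_units)
  obtain d0 where d0: "d0 \<in> D" using D by blast
  \<comment> \<open>If the weighted sum \<open>z a\<close> is null, node \<open>a\<close> does not influence the objective, and
    any unit vector within \<open>D\<close> will do.\<close>
  define z where "z = (\<lambda>a x. \<Sum>c\<in>C. W a c * y c x)"
  define L where "L = (\<lambda>i. if i \<in> C then y i else if B (z i) (z i) = 0 then unit_at d0
                      else (\<lambda>x. (1 / sqrt (B (z i) (z i))) * z i x))"
  define Y where "Y = (\<lambda>i j. B (L i) (L j))"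
  have Bnn: "B f f \<ge> 0" for f unfolding B_def by (rule gram_form_nonneg[OF psd])
  have L_unit: "B (L i) (L i) = 1" if "i \<in> ?V" for i
  proof (cases "i \<in> C \<or> B (z i) (z i) = 0")
    case True
    then show ?thesis using unit diag[of d0] X_B[of d0 d0] d0 D(1) by (auto simp: L_def)
  next
    case False
    then have "B (z i) (z i) > 0" using Bnn[of "z i"] by simp
    moreover have "B (\<lambda>x. c * z i x) (\<lambda>x. c * z i x) = c * (c * B (z i) (z i))" for c
      unfolding B_def gram_form_scaled_left gram_form_scaled_right[OF psd] by simp
    from this[of "1 / sqrt (B (z i) (z i))"] calculation show ?thesis
      using False by (simp add: L_def)
  qed
  have feas: "sdp_feasible G Y"
    unfolding sdp_feasible_def Y_def using L_unit psd_on_gram_matrix[OF psd fin]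
    by (simp add: B_def)
  have z_supp: "z a x = 0" if "x \<notin> D" for a x
    using supp that by (simp add: z_def)
  have rank: "rank_on ?V Y \<le> card D"
    unfolding Y_def B_def
  proof (rule rank_on_gram_matrix_le[OF psd finD])
    fix j x assume "j \<in> ?V" "x \<notin> D"
    then show "L j x = 0" using supp z_supp d0 by (auto simp: L_def unit_at_def)
  qed
  have outer_Y: "(\<Sum>c\<in>C. W a c * Y a c) = sqrt (B (z a) (z a))" if "a \<in> ?V - C" for a
  proof -
    have "(\<Sum>c\<in>C. W a c * Y a c) = (\<Sum>c\<in>C. W a c * B (L a) (y c))"
      by (intro sum.cong) (auto simp: Y_def L_def)
    also have "\<dots> = B (L a) (z a)"
      unfolding z_def B_def by (simp add: gram_form_sum_right[OF psd])
    also have "\<dots> = sqrt (B (z a) (z a))"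
    proof (cases "B (z a) (z a) = 0")
      case True
      then have "B (L a) (z a) = 0"
        using gram_form_null[OF psd, of "z a" "L a"] gram_form_sym[OF psd] unfolding B_def by metis
      then show ?thesis using True by simp
    next
      case False
      then have "B (z a) (z a) > 0" using Bnn[of "z a"] by simp
      moreover have "B (\<lambda>x. c * z a x) (z a) = c * B (z a) (z a)" for c
        unfolding B_def by (rule gram_form_scaled_left)
      from this[of "1 / sqrt (B (z a) (z a))"] calculation show ?thesis
        using False that by (simp add: L_def real_div_sqrt)
    qed
    finally show ?thesis .
  qed
  have outer_X: "(\<Sum>c\<in>C. W a c * X a c) \<le> sqrt (B (z a) (z a))" if a: "a \<in> ?V - C" for a
  proof -
    define z0 where "z0 = (\<lambda>x. \<Sum>c\<in>C. W a c * unit_at c x)"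
    have "B z0 z0 = (\<Sum>c\<in>C. \<Sum>d\<in>C. W a c * W a d * X c d)"
      using C unfolding z0_def B_def
      by (auto simp: gram_form_sum_left gram_form_sum_right[OF psd] sum_distrib_left
          gram_form_units[OF fin] mult.assoc subset_eq intro!: sum.cong)
    also have "\<dots> \<le> (\<Sum>c\<in>C. \<Sum>d\<in>C. W a c * W a d * B (y c) (y d))"
      by (intro sum_mono outer[OF a])
    also have "\<dots> = B (z a) (z a)"
      unfolding z_def B_def
      by (simp add: gram_form_sum_left gram_form_sum_right[OF psd] sum_distrib_left mult.assoc)
    finally have le: "B z0 z0 \<le> B (z a) (z a)" .
    have "(\<Sum>c\<in>C. W a c * X a c) = B (unit_at a) z0"
      using C a unfolding z0_def B_def
      by (auto simp: gram_form_sum_right[OF psd] gram_form_units[OF fin] subset_eq intro!: sum.cong)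
    moreover have "(B (unit_at a) z0)\<^sup>2 \<le> B z0 z0"
      using gram_form_Cauchy_Schwarz[OF psd, of "unit_at a" z0] X_B[of a a] diag[of a] a
      by (simp add: B_def)
    ultimately have "(\<Sum>c\<in>C. W a c * X a c)\<^sup>2 \<le> B (z a) (z a)" using le by simp
    then show ?thesis by (rule real_le_rsqrt)
  qed
  have "sdp_objective G w X =
      (\<Sum>c\<in>C. \<Sum>d\<in>C. W c d * X c d) / 2 + (\<Sum>a\<in>?V - C. \<Sum>c\<in>C. W a c * X a c)"
    unfolding W_def using psd by (intro sdp_objective_split[OF fin cover]) (auto simp: psd_on_def)
  also have "\<dots> \<le> (\<Sum>c\<in>C. \<Sum>d\<in>C. W c d * Y c d) / 2 + (\<Sum>a\<in>?V - C. \<Sum>c\<in>C. W a c * Y a c)"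
  proof (intro add_mono divide_right_mono)
    show "(\<Sum>c\<in>C. \<Sum>d\<in>C. W c d * X c d) \<le> (\<Sum>c\<in>C. \<Sum>d\<in>C. W c d * Y c d)"
      using core by (intro sum_mono) (auto simp: Y_def L_def)
    show "(\<Sum>a\<in>?V - C. \<Sum>c\<in>C. W a c * X a c) \<le> (\<Sum>a\<in>?V - C. \<Sum>c\<in>C. W a c * Y a c)"
    proof (rule sum_mono)
      fix a assume "a \<in> ?V - C"
      then show "(\<Sum>c\<in>C. W a c * X a c) \<le> (\<Sum>c\<in>C. W a c * Y a c)"
        using outer_X outer_Y by simp
    qed
  qed simp
  also have "\<dots> = sdp_objective G w Y"
    unfolding W_def using gram_form_sym[OF psd]
    by (intro sdp_objective_split[OF fin cover, symmetric]) (auto simp: Y_def B_def)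
  finally have "sdp_objective G w X \<le> sdp_objective G w Y" .
  then have "sdp_optimal G w Y"
    using feas opt unfolding sdp_optimal_def by (meson order_trans)
  then show ?thesis using rank by blast
qed

lemma low_rank_optimum_of_cover:
  assumes "finite (fst G)" "vertex_cover G C" "C \<noteq> {}"
  shows "\<exists>X. sdp_optimal G w X \<and> rank_on (fst G) X \<le> card C"
proof -
  obtain X where X: "sdp_optimal G w X" using sdp_optimal_exists[OF assms(1)] by blast
  have C: "C \<subseteq> fst G" using assms(2) by (simp add: vertex_cover_def)
  show ?thesis
    by (rule sdp_optimal_carried_by_cover[OF assms(1,2) X C assms(3), of unit_at])
       (use C X in \<open>auto simp: unit_at_def[THEN fun_cong] gram_form_units[OF assms(1)] subset_eq
         sdp_optimal_def sdp_feasible_def\<close>)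
qed

text \<open>Rotating \<open>t\<close> about the span of the other vectors until it falls into the span of those
  vectors together with \<open>s\<close> only changes its inner product with \<open>s\<close>. Write the vectors
  of \<open>s\<close> and \<open>t\<close> as their projections to the span of the others plus residuals \<open>u\<close>
  and \<open>u'\<close>; the rotation replaces \<open>u'\<close> by the multiple of \<open>u\<close> of the same
  length, and by Cauchy--Schwarz either sign of that multiple moves the inner product in the
  direction of the sign.\<close>

lemma gram_form_rotation:
  fixes V :: "'a set" and X C s t and \<epsilon> :: real
  defines "B \<equiv> gram_form V X"
  assumes fin: "finite V" and psd: "psd_on V X" and diag: "\<And>i. i \<in> V \<Longrightarrow> X i i = 1"
    and C: "C \<subseteq> V" and st: "s \<in> C" "t \<in> C" "s \<noteq> t" and \<epsilon>: "\<epsilon> = 1 \<or> \<epsilon> = - 1"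
  shows "\<exists>y D. D \<subseteq> C \<and> D \<noteq> {} \<and> card D < card C \<and> (\<forall>c\<in>C. \<forall>x. x \<notin> D \<longrightarrow> y c x = 0) \<and>
     (\<forall>c\<in>C. B (y c) (y c) = 1) \<and>
     (\<forall>c\<in>C. \<forall>d\<in>C. {c, d} \<noteq> {s, t} \<longrightarrow> B (y c) (y d) = X c d) \<and>
     \<epsilon> * X s t \<le> \<epsilon> * B (y s) (y t)"
proof -
  define D0 where "D0 = C - {s, t}"
  have finC: "finite C" and finD0: "finite D0"
    using fin C finite_subset by (auto simp: D0_def)
  have sym: "B f g = B g f" for f g unfolding B_def by (rule gram_form_sym[OF psd])
  have X_B: "B (unit_at i) (unit_at j) = X i j" if "i \<in> C" "j \<in> C" for i j
    using that C fin by (auto simp: B_def gram_form_units subset_eq)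
  have diag': "X i i = 1" if "i \<in> C" for i using that diag C by blast
  have Xsym: "X i j = X j i" if "i \<in> C" "j \<in> C" for i j using X_B that sym by metis
  obtain \<pi> where \<pi>: "\<And>x. x \<notin> D0 \<Longrightarrow> \<pi> x = 0"
      "\<And>d. d \<in> D0 \<Longrightarrow> B (\<lambda>x. unit_at s x - \<pi> x) (unit_at d) = 0"
    using gram_form_projection[OF psd finD0, of "unit_at s"] by (auto simp: B_def)
  obtain \<pi>' where \<pi>': "\<And>x. x \<notin> D0 \<Longrightarrow> \<pi>' x = 0"
      "\<And>d. d \<in> D0 \<Longrightarrow> B (\<lambda>x. unit_at t x - \<pi>' x) (unit_at d) = 0"
    using gram_form_projection[OF psd finD0, of "unit_at t"] by (auto simp: B_def)
  define u where "u = (\<lambda>x. unit_at s x - \<pi> x)"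
  define u' where "u' = (\<lambda>x. unit_at t x - \<pi>' x)"
  have orth: "B u f = 0" "B u' f = 0" if "\<And>x. x \<notin> D0 \<Longrightarrow> f x = 0" for f
    using gram_form_orthogonal_supported[OF psd finD0, of u f]
      gram_form_orthogonal_supported[OF psd finD0, of u' f] that \<pi>(2) \<pi>'(2)
    by (auto simp: B_def u_def u'_def)
  have s_eq: "B (unit_at s) f = B u f + B \<pi> f" for f
    unfolding u_def B_def by (simp add: gram_form_diff_left)
  have t_eq: "B (unit_at t) f = B u' f + B \<pi>' f" for f
    unfolding u'_def B_def by (simp add: gram_form_diff_left)
  show ?thesis
  proof (cases "B u u = 0")
    case True
    \<comment> \<open>Here \<open>s\<close> already lies in the span of the others, up to a null vector.\<close>
    have "B u f = 0" for f
      using gram_form_null[OF psd, of u] True by (simp add: B_def)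
    then have \<pi>_B: "B \<pi> f = B (unit_at s) f" "B f \<pi> = B f (unit_at s)" for f
      using s_eq[of f] sym[of f] by auto
    define y where "y = unit_at(s := \<pi>)"
    have inner: "B (y c) (y d) = X c d" if "c \<in> C" "d \<in> C" for c d
      using that X_B by (auto simp: y_def \<pi>_B)
    have supp: "y c x = 0" if "c \<in> C" "x \<notin> C - {s}" for c x
      using that \<pi>(1)[of x] by (auto simp: y_def unit_at_def D0_def)
    show ?thesis
    proof (intro exI[of _ y] exI[of _ "C - {s}"] conjI ballI allI impI)
      show "card (C - {s}) < card C" by (rule card_Diff1_less[OF finC st(1)])
      show "\<epsilon> * X s t \<le> \<epsilon> * B (y s) (y t)" using inner st by simp
    qed (use inner supp st diag' in auto)
  next
    case False
    define \<alpha> where "\<alpha> = sqrt (B u u)"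
    define \<beta> where "\<beta> = sqrt (B u' u')"
    define \<kappa> where "\<kappa> = \<epsilon> * \<beta> / \<alpha>"
    have Bnn: "B f f \<ge> 0" for f unfolding B_def by (rule gram_form_nonneg[OF psd])
    have \<alpha>: "\<alpha> > 0" "\<alpha> * \<alpha> = B u u" and \<beta>: "\<beta> * \<beta> = B u' u'"
      using False Bnn[of u] Bnn[of u'] by (auto simp: \<alpha>_def \<beta>_def)
    have \<epsilon>2: "\<epsilon> * \<epsilon> = 1" using \<epsilon> by auto
    define p where "p = (\<lambda>x. \<pi>' x + \<kappa> * u x)"
    have p_B: "B p f = B \<pi>' f + \<kappa> * B u f" for f
      unfolding p_def B_def by (rule gram_form_add_scaled_left)
    have "B p p = B \<pi>' \<pi>' + \<kappa> * \<kappa> * B u u"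
      using p_B[of p] p_B[of \<pi>'] p_B[of u] orth(1)[of \<pi>'] \<pi>'(1) sym[of \<pi>' p] sym[of u p]
        sym[of \<pi>' u] by (simp add: algebra_simps)
    also have "\<kappa> * \<kappa> * B u u = \<beta> * \<beta>"
    proof -
      have "\<kappa> * \<kappa> * (\<alpha> * \<alpha>) = (\<epsilon> * \<epsilon>) * (\<beta> * \<beta>)"
        using \<alpha>(1) by (simp add: \<kappa>_def)
      then show ?thesis by (simp only: \<alpha>(2) \<epsilon>2 mult_1)
    qed
    also have "B \<pi>' \<pi>' + \<beta> * \<beta> = B (unit_at t) (unit_at t)"
      using t_eq[of "unit_at t"] t_eq[of u'] t_eq[of \<pi>'] orth(2)[of \<pi>'] \<pi>'(1) \<beta>
        sym[of u' "unit_at t"] sym[of \<pi>' "unit_at t"] sym[of \<pi>' u'] by simp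
    finally have p_unit: "B p p = 1" using X_B[of t t] diag' st by simp
    have p_D0: "B p (unit_at d) = X t d" if "d \<in> D0" for d
    proof -
      have "B u (unit_at d) = 0" "B u' (unit_at d) = 0"
        using \<pi>(2) \<pi>'(2) that by (auto simp: u_def u'_def)
      then show ?thesis
        using p_B[of "unit_at d"] t_eq[of "unit_at d"] X_B[of t d] st that by (simp add: D0_def)
    qed
    have "B u (unit_at s) = B u u"
      using s_eq[of u] sym[of u "unit_at s"] sym[of u \<pi>] orth(1)[of \<pi>] \<pi>(1) by simp
    then have p_s: "B p (unit_at s) = B \<pi>' (unit_at s) + \<epsilon> * (\<alpha> * \<beta>)"
    proof -
      have "\<kappa> * (\<alpha> * \<alpha>) = \<epsilon> * (\<alpha> * \<beta>)"
        using \<alpha>(1) by (simp add: \<kappa>_def)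
      then show ?thesis
        using p_B[of "unit_at s"] \<open>B u (unit_at s) = B u u\<close> \<alpha>(2) by simp
    qed
    have t_s: "X t s = B \<pi>' (unit_at s) + B u' u"
      using t_eq[of "unit_at s"] X_B[of t s] st s_eq[of u'] sym[of u' "unit_at s"] sym[of u u']
        sym[of u' \<pi>] orth(2)[of \<pi>] \<pi>(1) by simp
    have "\<bar>B u' u\<bar> \<le> \<alpha> * \<beta>"
    proof -
      have "(B u' u)\<^sup>2 \<le> (\<alpha> * \<beta>)\<^sup>2"
      proof -
        have "(\<alpha> * \<beta>)\<^sup>2 = (\<beta> * \<beta>) * (\<alpha> * \<alpha>)" by (simp add: power2_eq_square)
        also have "\<dots> = B u' u' * B u u" by (simp only: \<alpha>(2) \<beta>)
        finally show ?thesis using gram_form_Cauchy_Schwarz[OF psd, of u' u] by (simp add: B_def)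
      qed
      moreover have "0 \<le> \<alpha> * \<beta>" using \<alpha> Bnn[of u'] by (simp add: \<beta>_def)
      ultimately show ?thesis using abs_le_square_iff[of "B u' u" "\<alpha> * \<beta>"] by simp
    qed
    then have sign: "\<epsilon> * X s t \<le> \<epsilon> * B (unit_at s) p"
      using \<epsilon> p_s t_s Xsym[of s t] st sym[of "unit_at s" p] by auto
    define y where "y = unit_at(t := p)"
    have inner: "B (y c) (y d) = X c d" if cd: "c \<in> C" "d \<in> C" "{c, d} \<noteq> {s, t}" for c d
    proof -
      consider "c \<noteq> t" "d \<noteq> t" | "c = t" "d = t" | "c = t" "d \<in> D0" | "d = t" "c \<in> D0"
        using cd by (cases "c = t"; cases "d = t") (auto simp: D0_def doubleton_eq_iff)
      then show ?thesis
      proof cases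
        case 1
        then show ?thesis using X_B cd by (simp add: y_def)
      next
        case 2
        then show ?thesis using p_unit diag' st by (simp add: y_def)
      next
        case 3
        then show ?thesis using p_D0[of d] st by (auto simp: y_def D0_def)
      next
        case 4
        then show ?thesis
          using p_D0[of c] st sym[of "unit_at c" p] Xsym[of t c] by (auto simp: y_def D0_def)
      qed
    qed
    have supp: "y c x = 0" if "c \<in> C" "x \<notin> C - {t}" for c x
      using that \<pi>(1)[of x] \<pi>'(1)[of x] st
      by (auto simp: y_def unit_at_def D0_def p_def u_def)
    have units: "B (y c) (y c) = 1" if "c \<in> C" for c
      using inner[OF that that] diag'[OF that] st(3) by auto
    show ?thesis
    proof (intro exI[of _ y] exI[of _ "C - {t}"] conjI ballI allI impI)
      show "card (C - {t}) < card C" by (rule card_Diff1_less[OF finC st(2)])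
      show "\<epsilon> * X s t \<le> \<epsilon> * B (y s) (y t)" using sign st by (simp add: y_def)
    qed (use inner supp units st in auto)
  qed
qed

text \<open>If one sign of a change of \<open>X s t\<close> never lowers the objective, the rotation above
  saves one dimension.\<close>

lemma low_rank_optimum_of_free_pair:
  assumes fin: "finite (fst G)" and cover: "vertex_cover G C"
    and st: "s \<in> C" "t \<in> C" "s \<noteq> t" and \<epsilon>: "\<epsilon> = 1 \<or> \<epsilon> = - 1"
    and core: "0 \<le> \<epsilon> * edge_weight G w s t"
    and outer: "\<And>a. a \<in> fst G - C \<Longrightarrow> 0 \<le> \<epsilon> * (edge_weight G w a s * edge_weight G w a t)"
  shows "\<exists>X. sdp_optimal G w X \<and> rank_on (fst G) X < card C"
proof -
  obtain X where X: "sdp_optimal G w X" using sdp_optimal_exists[OF fin] by blast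
  let ?B = "gram_form (fst G) X" and ?W = "edge_weight G w"
  have psd: "psd_on (fst G) X" and diag: "\<And>i. i \<in> fst G \<Longrightarrow> X i i = 1"
    using X by (auto simp: sdp_optimal_def sdp_feasible_def)
  have C: "C \<subseteq> fst G" using cover by (simp add: vertex_cover_def)
  obtain y D where D: "D \<subseteq> C" "D \<noteq> {}" "card D < card C"
    and supp: "\<And>c x. c \<in> C \<Longrightarrow> x \<notin> D \<Longrightarrow> y c x = 0"
    and unit: "\<And>c. c \<in> C \<Longrightarrow> ?B (y c) (y c) = 1"
    and inner: "\<And>c d. c \<in> C \<Longrightarrow> d \<in> C \<Longrightarrow> {c, d} \<noteq> {s, t} \<Longrightarrow> ?B (y c) (y d) = X c d"
    and sign: "\<epsilon> * X s t \<le> \<epsilon> * ?B (y s) (y t)"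
    using gram_form_rotation[OF fin psd diag C st \<epsilon>] by metis
  have mono: "b * X c d \<le> b * ?B (y c) (y d)"
    if "c \<in> C" "d \<in> C" "{c, d} = {s, t} \<Longrightarrow> 0 \<le> \<epsilon> * b" for b c d
  proof (cases "{c, d} = {s, t}")
    case True
    have le: "b * X s t \<le> b * ?B (y s) (y t)"
      using \<epsilon> that(3)[OF True] sign by (auto intro: mult_left_mono mult_left_mono_neg)
    have "X t s = X s t" "?B (y t) (y s) = ?B (y s) (y t)"
      using psd C st gram_form_sym[OF psd] by (auto simp: psd_on_def subset_eq)
    then show ?thesis using True le by (auto simp: doubleton_eq_iff)
  qed (use inner that in simp)
  have "\<exists>Y. sdp_optimal G w Y \<and> rank_on (fst G) Y \<le> card D"
  proof (rule sdp_optimal_carried_by_cover[OF fin cover X])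
    show "D \<subseteq> fst G" using D C by blast
    fix c d assume cd: "c \<in> C" "d \<in> C"
    show "?W c d * X c d \<le> ?W c d * ?B (y c) (y d)"
      using core edge_weight_sym[of G w s t] by (intro mono cd) (auto simp: doubleton_eq_iff)
    fix a assume a: "a \<in> fst G - C"
    show "?W a c * ?W a d * X c d \<le> ?W a c * ?W a d * ?B (y c) (y d)"
      using outer[OF a] by (intro mono cd) (auto simp: doubleton_eq_iff mult.commute)
  qed (use D supp unit in auto)
  then show ?thesis using D(3) by (meson le_less_trans)
qed

section \<open>A minor-closed sufficient condition for small extreme Gram dimension\<close>

text \<open>The ways in which the inner product of the vectors of \<open>s\<close> and \<open>t\<close> enters the
  objective, for a vertex cover \<open>C\<close>: through a common neighbour outside \<open>C\<close>, named by
  itself, or through the edge \<open>{s, t}\<close>, named by \<open>s\<close>, which is no clash because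
  \<open>s \<in> C\<close>.\<close>

definition links :: "'a graph \<Rightarrow> 'a set \<Rightarrow> 'a \<Rightarrow> 'a \<Rightarrow> 'a set" where
  "links G C s t = {x. x \<notin> C \<and> {x, s} \<in> snd G \<and> {x, t} \<in> snd G} \<union>
                   {x. x = s \<and> {s, t} \<in> snd G}"

text \<open>A combinatorial certificate for extreme Gram dimension at most \<open>k\<close>. The first
  alternative absorbs the minor operations that destroy the pair \<open>s\<close>, \<open>t\<close> of the second:
  each of these shrinks the cover.\<close>

definition low_cover :: "nat \<Rightarrow> 'a graph \<Rightarrow> bool" where
  "low_cover k G \<longleftrightarrow> simple_graph G \<and> (\<exists>C. vertex_cover G C \<and>
     (card C \<le> k \<or>
      card C \<le> Suc k \<and> (\<exists>s\<in>C. \<exists>t\<in>C. s \<noteq> t \<and> (\<forall>x\<in>links G C s t. \<forall>y\<in>links G C s t. x = y))))"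

lemma low_cover_cases:
  assumes "low_cover k G"
  obtains (small) C where "vertex_cover G C" "card C \<le> k"
  | (single_link) C s t where "vertex_cover G C" "card C \<le> Suc k" "s \<in> C" "t \<in> C" "s \<noteq> t"
      "\<And>x y. x \<in> links G C s t \<Longrightarrow> y \<in> links G C s t \<Longrightarrow> x = y"
  using assms unfolding low_cover_def by blast

lemma low_cover_small:
  "simple_graph G \<Longrightarrow> vertex_cover G C \<Longrightarrow> card C \<le> k \<Longrightarrow> low_cover k G"
  unfolding low_cover_def by blast

lemma low_cover_single_link:
  assumes "simple_graph G" "vertex_cover G C" "card C \<le> Suc k" "s \<in> C" "t \<in> C" "s \<noteq> t"
    "\<And>x y. x \<in> links G C s t \<Longrightarrow> y \<in> links G C s t \<Longrightarrow> x = y"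
  shows "low_cover k G"
  unfolding low_cover_def using assms by blast

lemma egd_le:
  assumes "k \<ge> 1" "\<And>w. \<exists>X. sdp_optimal G w X \<and> rank_on (fst G) X \<le> k"
  shows "egd G \<le> k"
  unfolding egd_def using assms by (intro Least_le) blast

lemma egd_le_card_vertex_cover:
  fixes G :: "'a graph"
  assumes "finite (fst G)" "vertex_cover G C" "card C \<le> k" "k \<ge> 1"
  shows "egd G \<le> k"
proof (cases "fst G = {}")
  case True
  have "rank_on (fst G) X \<le> k" for X
    using fun_vs.dim_le_card'[of "{} :: ('a \<Rightarrow> real) set"] by (simp add: rank_on_def True)
  then show ?thesis using egd_le[OF assms(4)] sdp_optimal_exists[OF assms(1)] by blast
next
  case False
  \<comment> \<open>An empty cover means that there are no edges; any single node then is a cover, and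
    the rank bound becomes 1.\<close>
  obtain C' where C': "vertex_cover G C'" "C' \<noteq> {}" "card C' \<le> k"
  proof (cases "C = {}")
    case True
    obtain v where "v \<in> fst G" using False by blast
    then have "vertex_cover G {v}" using assms(2) True by (auto simp: vertex_cover_def)
    then show ?thesis using that[of "{v}"] assms(4) by simp
  qed (use that assms in blast)
  show ?thesis
    using low_rank_optimum_of_cover[OF assms(1) C'(1,2)] C'(3)
    by (intro egd_le[OF assms(4)]) (meson order_trans)
qed

text \<open>A single link makes the objective monotone in \<open>X s t\<close>: an edge contributes a linear
  term, a common neighbour the norm of a sum \<open>a * y s + b * y t + \<dots>\<close>. So one sign is free,
  whatever the weights.\<close>

lemma egd_le_of_low_cover:
  assumes "low_cover k G" "k \<ge> 1"
  shows "egd G \<le> k"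
proof -
  have fin: "finite (fst G)" using assms(1) by (simp add: low_cover_def simple_graph_def)
  from assms(1) show ?thesis
  proof (cases rule: low_cover_cases)
    case (small C)
    then show ?thesis using egd_le_card_vertex_cover[OF fin] assms(2) by blast
  next
    case (single_link C s t)
    note cover = single_link(1) and card = single_link(2) and st = single_link(3-5)
      and one = single_link(6)
    have "\<exists>X. sdp_optimal G w X \<and> rank_on (fst G) X < card C" for w
    proof -
      let ?W = "edge_weight G w"
      \<comment> \<open>\<open>q x\<close> is the coefficient whose sign decides in which direction link \<open>x\<close>
        lets the objective grow.\<close>
      define q where "q = (\<lambda>x. if x = s then ?W s t else ?W x s * ?W x t)"
      have free: ?thesis if "\<epsilon> = 1 \<or> \<epsilon> = - 1" "\<And>x. x \<in> links G C s t \<Longrightarrow> 0 \<le> \<epsilon> * q x" for \<epsilon>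
      proof (rule low_rank_optimum_of_free_pair[OF fin cover st that(1)])
        show "0 \<le> \<epsilon> * ?W s t"
          using that(2)[of s] by (cases "{s, t} \<in> snd G") (auto simp: links_def edge_weight_def q_def)
        fix a assume a: "a \<in> fst G - C"
        then have "a \<noteq> s" using st by auto
        then show "0 \<le> \<epsilon> * (?W a s * ?W a t)"
          using that(2)[of a] a by (cases "a \<in> links G C s t") (auto simp: links_def edge_weight_def q_def)
      qed
      show ?thesis
      proof (cases "\<forall>x\<in>links G C s t. 0 \<le> q x")
        case True
        then show ?thesis by (intro free[of 1]) auto
      next
        case False
        then obtain x where x: "x \<in> links G C s t" "q x < 0" by (auto simp: not_le)
        then have "q y < 0" if "y \<in> links G C s t" for y using one[OF that x(1)] by simp
        then show ?thesis by (intro free[of "- 1"]) (auto intro: less_imp_le)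
      qed
    qed
    moreover have "n \<le> k" if "n < card C" for n using that card by simp
    ultimately show ?thesis by (intro egd_le[OF assms(2)]) blast
  qed
qed

lemma vertex_cover_edge:
  assumes "vertex_cover G C" "{a, b} \<in> snd G"
  shows "a \<in> C \<or> b \<in> C"
proof -
  have "\<forall>e\<in>snd G. e \<inter> C \<noteq> {}" using assms(1) by (simp add: vertex_cover_def)
  from bspec[OF this assms(2)] show ?thesis by blast
qed

lemma finite_vertex_cover: "simple_graph G \<Longrightarrow> vertex_cover G C \<Longrightarrow> finite C"
  by (auto simp: simple_graph_def vertex_cover_def intro: finite_subset)

text \<open>If \<open>s\<close> or \<open>t\<close> is lost, then so is a node of the cover.\<close>

lemma low_cover_subgraph:
  assumes low: "low_cover k G" and H: "simple_graph H" "fst H \<subseteq> fst G" "snd H \<subseteq> snd G"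
  shows "low_cover k H"
proof -
  have simple: "simple_graph G" using low by (simp add: low_cover_def)
  have cover: "vertex_cover H (C \<inter> fst H)" if "vertex_cover G C" for C
    unfolding vertex_cover_def
  proof (intro conjI ballI)
    fix e assume "e \<in> snd H"
    moreover from this have "e \<subseteq> fst H" "e \<in> snd G" using H by (auto simp: simple_graph_def)
    ultimately show "e \<inter> (C \<inter> fst H) \<noteq> {}" using that unfolding vertex_cover_def by blast
  qed simp
  from low show ?thesis
  proof (cases rule: low_cover_cases)
    case (small C)
    have "card (C \<inter> fst H) \<le> card C"
      using finite_vertex_cover[OF simple small(1)] by (intro card_mono) auto
    then show ?thesis using low_cover_small[OF H(1) cover[OF small(1)]] small(2) by simp
  next
    case (single_link C s t)
    have finC: "finite C" by (rule finite_vertex_cover[OF simple single_link(1)])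
    show ?thesis
    proof (cases "s \<in> fst H \<and> t \<in> fst H")
      case True
      have sub: "links H (C \<inter> fst H) s t \<subseteq> links G C s t"
        using H by (auto simp: links_def simple_graph_def)
      have "card (C \<inter> fst H) \<le> Suc k"
        using card_mono[of C "C \<inter> fst H"] finC single_link(2) by simp
      then show ?thesis
        using low_cover_single_link[OF H(1) cover[OF single_link(1)], of k s t]
          single_link(3-6) True sub by blast
    next
      case False
      then have "C \<inter> fst H \<subset> C" using single_link(3,4) by blast
      then have "card (C \<inter> fst H) < card C" by (rule psubset_card_mono[OF finC])
      then show ?thesis
        using low_cover_small[OF H(1) cover[OF single_link(1)]] single_link(2) by simp
    qed
  qed
qed

lemma low_cover_delete_edge: "low_cover k G \<Longrightarrow> low_cover k (delete_edge e G)"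
  by (rule low_cover_subgraph) (auto simp: low_cover_def simple_graph_def delete_edge_def)

lemma low_cover_delete_node: "low_cover k G \<Longrightarrow> low_cover k (delete_node v G)"
  by (rule low_cover_subgraph) (auto simp: low_cover_def simple_graph_def delete_node_def)

lemma simple_graph_contract_edge:
  assumes "simple_graph G" "{u, v} \<in> snd G"
  shows "simple_graph (contract_edge u v G)"
  unfolding simple_graph_def
proof (intro conjI ballI)
  let ?\<phi> = "id(v := u)"
  have uv: "u \<in> fst G" "v \<in> fst G" "u \<noteq> v"
    using assms by (auto simp: simple_graph_def card_insert_if)
  show "finite (fst (contract_edge u v G))"
    using assms by (simp add: contract_edge_def simple_graph_def)
  fix e' assume "e' \<in> snd (contract_edge u v G)"
  then obtain e where e: "e \<in> snd G" "e \<noteq> {u, v}" "e' = ?\<phi> ` e"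
    by (auto simp: contract_edge_def)
  then have e2: "e \<subseteq> fst G" "card e = 2" using assms by (auto simp: simple_graph_def)
  then show "e' \<subseteq> fst (contract_edge u v G)"
    using e uv by (auto simp: contract_edge_def)
  have "inj_on ?\<phi> e"
  proof (rule inj_onI)
    fix x y assume xy: "x \<in> e" "y \<in> e" "?\<phi> x = ?\<phi> y"
    show "x = y"
    proof (rule ccontr)
      assume "x \<noteq> y"
      moreover from this have "{x, y} = {u, v}" using xy(3) by (auto split: if_splits)
      moreover have "e = {x, y}"
        using xy(1,2) \<open>x \<noteq> y\<close> e2(2) by (auto simp: card_2_iff)
      ultimately show False using e(2) by simp
    qed
  qed
  from card_image[OF this] show "card e' = 2" by (simp only: e(3) e2(2))
qed

text \<open>Contracting an edge inside the cover makes the cover smaller. Contracting an edge that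
  leaves the cover can turn a common neighbour of \<open>s\<close> and \<open>t\<close> into an edge between
  them, but that neighbour is then gone: no link is created.\<close>

lemma low_cover_contract_edge:
  assumes "low_cover k G" "{u, v} \<in> snd G"
  shows "low_cover k (contract_edge u v G)"
proof -
  let ?H = "contract_edge u v G" and ?\<phi> = "id(v := u)"
  have simple_G: "simple_graph G" using assms(1) by (simp add: low_cover_def)
  have simple: "simple_graph ?H" by (rule simple_graph_contract_edge[OF simple_G assms(2)])
  have fin: "finite (fst G)" and uv: "u \<in> fst G" "v \<in> fst G" "u \<noteq> v"
    using simple_G assms(2) by (auto simp: simple_graph_def card_insert_if)
  have cover': "vertex_cover ?H (?\<phi> ` C)" if cover: "vertex_cover G C" for C
    unfolding vertex_cover_def
  proof (intro conjI ballI)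
    show "?\<phi> ` C \<subseteq> fst ?H" using cover uv by (auto simp: vertex_cover_def contract_edge_def)
    fix e' assume "e' \<in> snd ?H"
    then obtain e where e: "e \<in> snd G" "e' = ?\<phi> ` e" by (auto simp: contract_edge_def)
    then obtain c where "c \<in> e" "c \<in> C"
      using cover unfolding vertex_cover_def by blast
    then have "?\<phi> c \<in> e' \<inter> ?\<phi> ` C" using e(2) by blast
    then show "e' \<inter> ?\<phi> ` C \<noteq> {}" by blast
  qed
  have card_C': "card (?\<phi> ` C) \<le> card C" if "vertex_cover G C" for C
    by (rule card_image_le[OF finite_vertex_cover[OF simple_G that]])
  from assms(1) show ?thesis
  proof (cases rule: low_cover_cases)
    case (small C)
    then show ?thesis
      using low_cover_small[OF simple cover'[OF small(1)]] card_C'[OF small(1)] by simp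
  next
    case (single_link C s t)
    note cover = single_link(1) and st = single_link(3-5) and single = single_link(6)
    have finC: "finite C" by (rule finite_vertex_cover[OF simple_G cover])
    have meets: "u \<in> C \<or> v \<in> C" by (rule vertex_cover_edge[OF cover assms(2)])
    show ?thesis
    proof (cases "u \<in> C \<and> v \<in> C")
      case True
      have "?\<phi> ` C = C - {v}" using True uv by auto
      then have "card (?\<phi> ` C) \<le> k" using True finC single_link(2) by simp
      then show ?thesis by (rule low_cover_small[OF simple cover'[OF cover]])
    next
      case False
      define C' where "C' = ?\<phi> ` C"
      have inj: "x = y" if "x \<in> C" "y \<in> C" "?\<phi> x = ?\<phi> y" for x y
        using that False by (auto split: if_splits)
      have end_C: "y = s" if "?\<phi> y = ?\<phi> s" "y \<in> C" "s \<in> C" for y s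
        using inj[of y s] that by simp
      have twin: "{y, s} = {u, v}" if "?\<phi> y = ?\<phi> s" "y \<noteq> s" for y s
        using that by (auto split: if_splits)
      have u_C': "u \<in> C'" using meets by (auto simp: C'_def)
      \<comment> \<open>Exactly one of \<open>u\<close> and \<open>v\<close> is in the cover, so the contraction is injective on
        it. Links of the contracted graph are traced back to links of \<open>G\<close>: a common neighbour
        to itself, and the edge to the old edge or to the node outside the cover that has been
        merged into \<open>s\<close> or \<open>t\<close>.\<close>
      have edge_E: "\<exists>y z. {y, z} \<in> snd G \<and> ?\<phi> y = a \<and> ?\<phi> z = b \<and> {y, z} \<noteq> {u, v}"
        if ab: "{a, b} \<in> snd ?H" for a b
      proof -
        obtain e where e: "e \<in> snd G" "e \<noteq> {u, v}" "{a, b} = ?\<phi> ` e"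
          using ab by (auto simp: contract_edge_def)
        obtain y z where "e = {y, z}" using e(1) simple_G by (auto simp: simple_graph_def card_2_iff)
        then have "{?\<phi> y, ?\<phi> z} = {a, b}" "{y, z} \<in> snd G" "{z, y} \<in> snd G"
            "{y, z} \<noteq> {u, v}" "{z, y} \<noteq> {u, v}"
          using e by (simp_all add: insert_commute)
        then show ?thesis unfolding doubleton_eq_iff[of "?\<phi> y"] by blast
      qed
      have outside: "x \<notin> C \<and> x \<noteq> u \<and> x \<noteq> v \<and> {x, s'} \<in> snd G"
        if x: "x \<notin> C'" "{x, ?\<phi> s'} \<in> snd ?H" "s' \<in> C" for x s'
      proof -
        obtain y z where yz: "{y, z} \<in> snd G" "?\<phi> y = x" "?\<phi> z = ?\<phi> s'"
          using edge_E[OF x(2)] by blast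
        have xuv: "x \<noteq> u" "x \<noteq> v" using x(1) u_C' yz(2) uv by (auto split: if_splits)
        then have y: "y = x" using yz(2) by (auto split: if_splits)
        have xC: "x \<notin> C" using x(1) xuv by (force simp: C'_def)
        then have "z \<in> C" using vertex_cover_edge[OF cover yz(1)] y by blast
        then have "z = s'" using end_C[of z s'] yz(3) x(3) by simp
        then show ?thesis using xC xuv yz y by simp
      qed
      have edge_link: "\<exists>x. x \<in> links G C s t \<and> (x = s \<or> x \<in> {u, v})" if edge: "{?\<phi> s, ?\<phi> t} \<in> snd ?H"
      proof -
        obtain y z where yz: "{y, z} \<in> snd G" "?\<phi> y = ?\<phi> s" "?\<phi> z = ?\<phi> t" "{y, z} \<noteq> {u, v}"
          using edge_E[OF edge] by blast
        consider "y \<in> C" "z \<in> C" | "y \<notin> C" "z \<in> C" | "y \<in> C" "z \<notin> C"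
          using vertex_cover_edge[OF cover yz(1)] by blast
        then show ?thesis
        proof cases
          case 1
          then have "y = s" "z = t" using end_C[of y s] end_C[of z t] yz st by auto
          then show ?thesis using yz by (intro exI[of _ s]) (simp add: links_def)
        next
          case 2
          then have "z = t" "{y, s} = {u, v}" using end_C[of z t] twin[of y s] yz st by auto
          then have "{y, s} \<in> snd G" "{y, t} \<in> snd G" "y \<in> {u, v}"
            using assms(2) yz(1) by auto
          then show ?thesis using 2 by (intro exI[of _ y]) (simp add: links_def)
        next
          case c3: 3
          then have "y = s" "{z, t} = {u, v}" using end_C[of y s] twin[of z t] yz st by auto
          then have "{z, t} \<in> snd G" "{z, s} \<in> snd G" "z \<in> {u, v}"
            using assms(2) yz(1) by (auto simp: insert_commute)
          then show ?thesis using c3 by (intro exI[of _ z]) (simp add: links_def)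
        qed
      qed
      have one: "x = y" if x: "x \<in> links ?H C' (?\<phi> s) (?\<phi> t)" and y: "y \<in> links ?H C' (?\<phi> s) (?\<phi> t)"
        for x y
      proof -
        define new where "new = (\<lambda>x. x \<in> links G C s t \<and> x \<notin> C \<and> x \<noteq> u \<and> x \<noteq> v)"
        have dich: "(x = ?\<phi> s \<and> {?\<phi> s, ?\<phi> t} \<in> snd ?H) \<or> new x"
          if "x \<in> links ?H C' (?\<phi> s) (?\<phi> t)" for x
          using that outside[of x s] outside[of x t] st(1,2)
          unfolding new_def links_def[of ?H] by (auto simp: links_def)
        have new_eq: "x = y" if "new x" "new y" for x y
          using single[of x y] that by (simp add: new_def)
        have not_new: "\<not> new x" if edge: "{?\<phi> s, ?\<phi> t} \<in> snd ?H" for x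
        proof
          assume x: "new x"
          obtain z where "z \<in> links G C s t" "z = s \<or> z \<in> {u, v}" using edge_link[OF edge] by blast
          moreover from this x have "x = z" using single[of x z] by (simp add: new_def)
          ultimately show False using x st(1) by (auto simp: new_def)
        qed
        show ?thesis
        proof (cases "{?\<phi> s, ?\<phi> t} \<in> snd ?H")
          case True
          then show ?thesis using dich[OF x] dich[OF y] not_new[OF True] by metis
        next
          case False
          then show ?thesis using dich[OF x] dich[OF y] new_eq by metis
        qed
      qed
      have distinct: "?\<phi> s \<noteq> ?\<phi> t" using inj[of s t] st by metis
      have in_C': "?\<phi> s \<in> C'" "?\<phi> t \<in> C'" unfolding C'_def using st(1,2) by (simp_all only: imageI)
      have "card C' \<le> Suc k" using card_C'[OF cover] single_link(2) by (simp add: C'_def)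
      moreover have "vertex_cover ?H C'" unfolding C'_def by (rule cover'[OF cover])
      ultimately show ?thesis by (intro low_cover_single_link[OF simple _ _ in_C' distinct one])
    qed
  qed
qed

lemma low_cover_minor_step:
  assumes "minor_step G H" "low_cover k G"
  shows "low_cover k H"
  using assms by cases (auto intro: low_cover_delete_edge low_cover_delete_node low_cover_contract_edge)

text \<open>Deleting a node also deletes the edges at it, so one of them may be deleted first. In
  a triangle \<open>u\<close>, \<open>v\<close>, \<open>z\<close>, contracting \<open>{u, v}\<close> identifies the
  other two edges, so one of these may be deleted first. Hence a proper minor of a graph covered
  by triangles is already obtained from one of its edge deletions.\<close>

lemma low_cover_proper_minor:
  assumes simple: "simple_graph G"
    and del: "\<And>e. e \<in> snd G \<Longrightarrow> low_cover k (delete_edge e G)"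
    and node: "\<And>v. v \<in> fst G \<Longrightarrow> \<exists>e\<in>snd G. v \<in> e"
    and triangle: "\<And>u v. {u, v} \<in> snd G \<Longrightarrow> \<exists>z. z \<noteq> u \<and> z \<noteq> v \<and> {u, z} \<in> snd G \<and> {v, z} \<in> snd G"
    and minor: "proper_minor H G"
  shows "low_cover k H"
proof -
  have step: "low_cover k H" if "minor_step G H" for H
    using that
  proof cases
    case (edge_deletion e)
    then show ?thesis using del by simp
  next
    case (edge_contraction u v)
    obtain z where z: "z \<noteq> u" "z \<noteq> v" "{u, z} \<in> snd G" "{v, z} \<in> snd G"
      using triangle[OF edge_contraction(2)] by blast
    let ?G = "delete_edge {v, z} G"
    have "u \<noteq> v" using simple edge_contraction(2) by (auto simp: simple_graph_def card_insert_if)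
    then have ne: "{u, z} \<noteq> {v, z}" "{u, z} \<noteq> {u, v}" "{u, v} \<noteq> {v, z}"
      using z by (auto simp: doubleton_eq_iff)
    have same: "id(v := u) ` {v, z} = id(v := u) ` {u, z}" using z by auto
    have "(\<lambda>e. id(v := u) ` e) ` (snd G - {{u, v}}) = (\<lambda>e. id(v := u) ` e) ` (snd G - {{v, z}} - {{u, v}})"
      (is "?f ` _ = _")
    proof (intro subset_antisym image_subsetI)
      fix e assume e: "e \<in> snd G - {{u, v}}"
      show "?f e \<in> ?f ` (snd G - {{v, z}} - {{u, v}})"
      proof (cases "e = {v, z}")
        case True
        have "{u, z} \<in> snd G - {{v, z}} - {{u, v}}" using z ne by simp
        then show ?thesis using same True by (metis image_eqI)
      qed (use e in blast)
    qed blast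
    then have "contract_edge u v G = contract_edge u v ?G"
      by (simp add: contract_edge_def delete_edge_def)
    moreover have "{u, v} \<in> snd ?G" using edge_contraction(2) ne by (simp add: delete_edge_def)
    ultimately show ?thesis
      using edge_contraction(1) low_cover_contract_edge[OF del[OF z(4)]] by metis
  next
    case (node_deletion v)
    obtain e where e: "e \<in> snd G" "v \<in> e" using node node_deletion(2) by blast
    have "delete_node v G = delete_node v (delete_edge e G)"
      using e by (auto simp: delete_node_def delete_edge_def)
    then show ?thesis using node_deletion(1) low_cover_delete_node[OF del[OF e(1)]] by metis
  qed
  from minor have "minor_step\<^sup>+\<^sup>+ G H" by (simp add: proper_minor_def)
  then show ?thesis
    by (induction rule: tranclp_induct) (auto intro: step low_cover_minor_step)
qed

section \<open>The graph $F_r$\<close>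

definition node_pairs :: "nat \<Rightarrow> (nat \<times> nat) set" where
  "node_pairs r = {(i, j). 1 \<le> i \<and> i < j \<and> j \<le> r}"

abbreviation core :: "nat \<Rightarrow> fnode set" where
  "core r \<equiv> Vert ` {1..r}"

lemma finite_node_pairs: "finite (node_pairs r)"
  by (rule finite_subset[of _ "{1..r} \<times> {1..r}"]) (auto simp: node_pairs_def)

lemma F_nodes: "fst (F_graph r) = core r \<union> (\<lambda>(i, j). Apex i j) ` node_pairs r"
  by (auto simp: F_graph_def node_pairs_def)

lemma F_edge_iff:
  "e \<in> snd (F_graph r) \<longleftrightarrow> (\<exists>(i, j) \<in> node_pairs r.
     e = {Vert i, Vert j} \<or> e = {Vert i, Apex i j} \<or> e = {Vert j, Apex i j})"
  by (auto simp: F_graph_def node_pairs_def)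

lemma F_Vert_Vert_edge:
  "{Vert i, Vert j} \<in> snd (F_graph r) \<longleftrightarrow> i \<noteq> j \<and> i \<in> {1..r} \<and> j \<in> {1..r}"
proof
  assume "i \<noteq> j \<and> i \<in> {1..r} \<and> j \<in> {1..r}"
  then have "(i, j) \<in> node_pairs r \<or> (j, i) \<in> node_pairs r" by (auto simp: node_pairs_def)
  then show "{Vert i, Vert j} \<in> snd (F_graph r)"
    unfolding F_edge_iff by (auto simp: doubleton_eq_iff)
qed (auto simp: F_edge_iff node_pairs_def doubleton_eq_iff)

lemma F_Apex_Vert_edge:
  "{Apex i j, Vert c} \<in> snd (F_graph r) \<longleftrightarrow> (i, j) \<in> node_pairs r \<and> (c = i \<or> c = j)"
  by (auto simp: F_edge_iff doubleton_eq_iff)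

lemma simple_graph_F: "simple_graph (F_graph r)"
  unfolding simple_graph_def
proof (intro conjI ballI)
  show "finite (fst (F_graph r))" by (simp add: F_nodes finite_node_pairs)
  fix e assume "e \<in> snd (F_graph r)"
  then obtain i j where ij: "(i, j) \<in> node_pairs r"
      "e = {Vert i, Vert j} \<or> e = {Vert i, Apex i j} \<or> e = {Vert j, Apex i j}"
    by (auto simp: F_edge_iff)
  then show "card e = 2" by (auto simp: node_pairs_def)
  show "e \<subseteq> fst (F_graph r)" using ij by (force simp: F_nodes node_pairs_def)
qed

lemma vertex_cover_F: "vertex_cover (F_graph r) (core r)"
  by (auto simp: vertex_cover_def F_nodes F_edge_iff node_pairs_def)

lemma card_core: "card (core r) = r"
  by (simp add: card_image inj_on_def)

text \<open>Two clique nodes have exactly two links, their edge and their apex, and every edge of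
  $F_r$ belongs to one of these. So each edge deletion leaves a pair with a single link.\<close>

lemma low_cover_F_delete_edge:
  assumes "e \<in> snd (F_graph r)"
  shows "low_cover (r - 1) (delete_edge e (F_graph r))"
proof -
  let ?G = "delete_edge e (F_graph r)"
  obtain i j where ij: "(i, j) \<in> node_pairs r"
      "e = {Vert i, Vert j} \<or> e = {Vert i, Apex i j} \<or> e = {Vert j, Apex i j}"
    using assms by (auto simp: F_edge_iff)
  have in_core: "Vert i \<in> core r" "Vert j \<in> core r" "Vert i \<noteq> Vert j" "r \<ge> 1"
    using ij(1) by (auto simp: node_pairs_def)
  have simple: "simple_graph ?G"
    using simple_graph_F[of r] by (auto simp: simple_graph_def delete_edge_def)
  have cover: "vertex_cover ?G (core r)"
    using vertex_cover_F[of r] by (auto simp: vertex_cover_def delete_edge_def)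
  have "x = Apex i j" if x: "x \<notin> core r" "{x, Vert i} \<in> snd (F_graph r)" "{x, Vert j} \<in> snd (F_graph r)" for x
  proof (cases x)
    case (Vert k)
    then show ?thesis using x by (auto simp: F_Vert_Vert_edge)
  next
    case (Apex a b)
    then show ?thesis using x(2,3) ij(1) by (auto simp: F_Apex_Vert_edge node_pairs_def)
  qed
  then have links: "x = Apex i j \<and> {Apex i j, Vert i} \<noteq> e \<and> {Apex i j, Vert j} \<noteq> e \<or>
      x = Vert i \<and> {Vert i, Vert j} \<noteq> e"
    if "x \<in> links ?G (core r) (Vert i) (Vert j)" for x
    using that by (auto simp: links_def delete_edge_def)
  have "x = y" if "x \<in> links ?G (core r) (Vert i) (Vert j)" "y \<in> links ?G (core r) (Vert i) (Vert j)" for x y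
    using links[OF that(1)] links[OF that(2)] ij(2) by (auto simp: insert_commute)
  moreover have "card (core r) \<le> Suc (r - 1)" using in_core(4) by (simp only: card_core)
  ultimately show ?thesis
    unfolding low_cover_def using simple cover in_core(1-3) by blast
qed

lemma low_cover_F_proper_minor:
  assumes "r \<ge> 2" "proper_minor H (F_graph r)"
  shows "low_cover (r - 1) H"
proof (rule low_cover_proper_minor[OF simple_graph_F low_cover_F_delete_edge _ _ assms(2)])
  fix v assume "v \<in> fst (F_graph r)"
  then consider c where "v = Vert c" "c \<in> {1..r}" | i j where "v = Apex i j" "(i, j) \<in> node_pairs r"
    by (auto simp: F_nodes)
  then show "\<exists>e\<in>snd (F_graph r). v \<in> e"
  proof cases
    case 1
    have "\<exists>d\<in>{1..r}. d \<noteq> c"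
      using assms(1) by (intro bexI[of _ "if c = 1 then 2 else 1"]) auto
    then obtain d where "d \<in> {1..r}" "d \<noteq> c" by blast
    then have "{Vert c, Vert d} \<in> snd (F_graph r)" using 1 by (simp add: F_Vert_Vert_edge)
    then show ?thesis using 1 by blast
  next
    case 2
    then have "{Apex i j, Vert i} \<in> snd (F_graph r)" by (simp add: F_Apex_Vert_edge)
    then show ?thesis using 2 by blast
  qed
next
  fix u v assume "{u, v} \<in> snd (F_graph r)"
  then obtain i j where ij: "(i, j) \<in> node_pairs r"
      "{u, v} = {Vert i, Vert j} \<or> {u, v} = {Vert i, Apex i j} \<or> {u, v} = {Vert j, Apex i j}"
    by (auto simp: F_edge_iff)
  have E: "{Vert i, Vert j} \<in> snd (F_graph r)" "{Vert i, Apex i j} \<in> snd (F_graph r)"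
      "{Vert j, Apex i j} \<in> snd (F_graph r)" "i \<noteq> j"
    using ij(1) by (auto simp: F_edge_iff node_pairs_def)
  have E': "{Vert j, Vert i} \<in> snd (F_graph r)" "{Apex i j, Vert i} \<in> snd (F_graph r)"
      "{Apex i j, Vert j} \<in> snd (F_graph r)"
    using E by (metis insert_commute)+
  from ij(2) show "\<exists>z. z \<noteq> u \<and> z \<noteq> v \<and> {u, z} \<in> snd (F_graph r) \<and> {v, z} \<in> snd (F_graph r)"
  proof (elim disjE)
    assume "{u, v} = {Vert i, Vert j}"
    then show ?thesis using E by (intro exI[of _ "Apex i j"]) (auto simp: doubleton_eq_iff)
  next
    assume "{u, v} = {Vert i, Apex i j}"
    then show ?thesis using E E' by (intro exI[of _ "Vert j"]) (auto simp: doubleton_eq_iff)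
  next
    assume "{u, v} = {Vert j, Apex i j}"
    then show ?thesis using E E' by (intro exI[of _ "Vert i"]) (auto simp: doubleton_eq_iff)
  qed
qed

section \<open>Weights that force an orthonormal clique\<close>

lemma sum_off_diagonal:
  fixes g :: "nat \<Rightarrow> nat \<Rightarrow> real"
  assumes "\<And>i j. i \<in> {1..r} \<Longrightarrow> j \<in> {1..r} \<Longrightarrow> g i j = g j i"
  shows "(\<Sum>i\<in>{1..r}. \<Sum>j\<in>{1..r}. if i \<noteq> j then g i j else 0) = 2 * (\<Sum>(i, j)\<in>node_pairs r. g i j)"
proof -
  let ?P = "node_pairs r" and ?Q = "(\<lambda>(i, j). (j, i)) ` node_pairs r"
  have "(\<Sum>i\<in>{1..r}. \<Sum>j\<in>{1..r}. if i \<noteq> j then g i j else 0) =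
      (\<Sum>(i, j)\<in>{1..r} \<times> {1..r}. if i \<noteq> j then g i j else 0)"
    by (rule sum.cartesian_product)
  also have "\<dots> = (\<Sum>(i, j)\<in>?P \<union> ?Q. g i j)"
  proof (rule sum.mono_neutral_cong_right)
    show "?P \<union> ?Q \<subseteq> {1..r} \<times> {1..r}" by (auto simp: node_pairs_def)
    show "\<forall>p\<in>{1..r} \<times> {1..r} - (?P \<union> ?Q). (case p of (i, j) \<Rightarrow> if i \<noteq> j then g i j else 0) = 0"
    proof
      fix p assume p: "p \<in> {1..r} \<times> {1..r} - (?P \<union> ?Q)"
      obtain i j where ij: "p = (i, j)" by (cases p)
      have "(j, i) \<notin> ?P" using p ij by force
      then have "i = j" using p ij by (auto simp: node_pairs_def)
      then show "(case p of (i, j) \<Rightarrow> if i \<noteq> j then g i j else 0) = 0" using ij by simp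
    qed
    show "(case p of (i, j) \<Rightarrow> if i \<noteq> j then g i j else 0) = (case p of (i, j) \<Rightarrow> g i j)"
      if "p \<in> ?P \<union> ?Q" for p
      using that by (auto simp: node_pairs_def)
  qed simp
  also have "\<dots> = (\<Sum>(i, j)\<in>?P. g i j) + (\<Sum>(i, j)\<in>?Q. g i j)"
    by (rule sum.union_disjoint) (auto simp: finite_node_pairs, auto simp: node_pairs_def)
  also have "(\<Sum>(i, j)\<in>?Q. g i j) = (\<Sum>(i, j)\<in>?P. g j i)"
    by (subst sum.reindex) (auto simp: inj_on_def case_prod_beta)
  also have "\<dots> = (\<Sum>(i, j)\<in>?P. g i j)"
    by (intro sum.cong refl) (auto simp: node_pairs_def intro!: assms)
  finally show ?thesis by simp
qed

text \<open>For the three unit vectors of a triangle with inner product \<open>x\<close> between the clique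
  vectors, the best apex vector contributes \<open>sqrt 2 * sqrt (2 + 2 * x)\<close>. The weight
  \<open>sqrt 2\<close> is chosen such that \<open>2 * sqrt (1 + x) - x\<close> has its unique maximum at
  \<open>x = 0\<close>.\<close>

definition F_weight :: "fnode set \<Rightarrow> real" where
  "F_weight e = (if e \<subseteq> range Vert then - 1 else sqrt 2)"

definition triangle_value :: "(fnode \<Rightarrow> fnode \<Rightarrow> real) \<Rightarrow> nat \<Rightarrow> nat \<Rightarrow> real" where
  "triangle_value X i j =
     sqrt 2 * X (Apex i j) (Vert i) + sqrt 2 * X (Apex i j) (Vert j) - X (Vert i) (Vert j)"

lemma sdp_objective_F:
  assumes "sdp_feasible (F_graph r) X"
  shows "sdp_objective (F_graph r) F_weight X = (\<Sum>(i, j)\<in>node_pairs r. triangle_value X i j)"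
proof -
  let ?G = "F_graph r" and ?W = "edge_weight (F_graph r) F_weight"
  have fin: "finite (fst ?G)" using simple_graph_F by (simp add: simple_graph_def)
  have sym: "X i j = X j i" if "i \<in> fst ?G" "j \<in> fst ?G" for i j
    using assms that by (simp add: sdp_feasible_def psd_on_def)
  have inj: "inj_on Vert {1..r}" "inj_on (\<lambda>(i, j). Apex i j) (node_pairs r)"
    by (auto simp: inj_on_def)
  have "(\<Sum>c\<in>core r. \<Sum>d\<in>core r. ?W c d * X c d) =
      (\<Sum>i\<in>{1..r}. \<Sum>j\<in>{1..r}. if i \<noteq> j then - X (Vert i) (Vert j) else 0)"
    unfolding sum.reindex[OF inj(1)] o_def
    by (intro sum.cong refl) (auto simp: edge_weight_def F_Vert_Vert_edge F_weight_def)
  also have "\<dots> = 2 * (\<Sum>(i, j)\<in>node_pairs r. - X (Vert i) (Vert j))"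
    using sym by (intro sum_off_diagonal) (simp add: F_nodes)
  finally have clique: "(\<Sum>c\<in>core r. \<Sum>d\<in>core r. ?W c d * X c d) / 2 =
      (\<Sum>(i, j)\<in>node_pairs r. - X (Vert i) (Vert j))" by simp
  have apex: "(\<Sum>c\<in>core r. ?W (Apex i j) c * X (Apex i j) c) =
      sqrt 2 * X (Apex i j) (Vert i) + sqrt 2 * X (Apex i j) (Vert j)"
    if ij: "(i, j) \<in> node_pairs r" for i j
  proof -
    have "(\<Sum>c\<in>core r. ?W (Apex i j) c * X (Apex i j) c) =
        (\<Sum>c\<in>{i, j}. sqrt 2 * X (Apex i j) (Vert c))"
      unfolding sum.reindex[OF inj(1)] o_def
      using ij by (intro sum.mono_neutral_cong_right)
        (auto simp: edge_weight_def F_Apex_Vert_edge F_weight_def node_pairs_def)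
    then show ?thesis using ij by (simp add: node_pairs_def)
  qed
  have outside: "fst ?G - core r = (\<lambda>(i, j). Apex i j) ` node_pairs r"
    by (auto simp: F_nodes)
  have outer: "(\<Sum>a\<in>fst ?G - core r. \<Sum>c\<in>core r. ?W a c * X a c) =
      (\<Sum>(i, j)\<in>node_pairs r. sqrt 2 * X (Apex i j) (Vert i) + sqrt 2 * X (Apex i j) (Vert j))"
    unfolding outside sum.reindex[OF inj(2)]
  proof (intro sum.cong refl)
    fix p assume "p \<in> node_pairs r"
    moreover obtain i j where "p = (i, j)" by (cases p)
    ultimately show "((\<lambda>a. \<Sum>c\<in>core r. ?W a c * X a c) \<circ> (\<lambda>(i, j). Apex i j)) p =
        (case p of (i, j) \<Rightarrow> sqrt 2 * X (Apex i j) (Vert i) + sqrt 2 * X (Apex i j) (Vert j))"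
      using apex[of i j] by (simp only: o_def prod.case)
  qed
  have "sdp_objective ?G F_weight X = (\<Sum>c\<in>core r. \<Sum>d\<in>core r. ?W c d * X c d) / 2 +
      (\<Sum>a\<in>fst ?G - core r. \<Sum>c\<in>core r. ?W a c * X a c)"
    by (rule sdp_objective_split[OF fin vertex_cover_F]) (rule sym)
  also have "\<dots> = (\<Sum>(i, j)\<in>node_pairs r. - X (Vert i) (Vert j)) +
      (\<Sum>(i, j)\<in>node_pairs r. sqrt 2 * X (Apex i j) (Vert i) + sqrt 2 * X (Apex i j) (Vert j))"
    by (simp only: clique outer)
  also have "\<dots> = (\<Sum>(i, j)\<in>node_pairs r. triangle_value X i j)"
    by (simp add: sum.distrib[symmetric] triangle_value_def case_prod_beta)
  finally show ?thesis .
qed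

text \<open>With \<open>m = v\<^sub>i + v\<^sub>j - sqrt 2 * v\<^sub>i\<^sub>j\<close> the square of the norm of \<open>m\<close> is
  \<open>4 - 2 * triangle_value X i j\<close>. In the case of equality \<open>m = 0\<close>, and pairing it with
  \<open>v\<^sub>i\<close> and \<open>v\<^sub>j\<close> determines the inner product.\<close>

lemma triangle_value_le:
  assumes feas: "sdp_feasible (F_graph r) X" and ij: "(i, j) \<in> node_pairs r"
  shows "triangle_value X i j \<le> 2"
    and "triangle_value X i j = 2 \<Longrightarrow> X (Vert i) (Vert j) = 0"
proof -
  let ?V = "fst (F_graph r)" and ?a = "Vert i" and ?b = "Vert j" and ?c = "Apex i j"
  let ?B = "gram_form ?V X"
  have fin: "finite ?V" using simple_graph_F by (simp add: simple_graph_def)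
  have psd: "psd_on ?V X" using feas by (simp add: sdp_feasible_def)
  have "i \<in> {1..r}" "j \<in> {1..r}" using ij by (auto simp: node_pairs_def)
  then have V: "?a \<in> ?V" "?b \<in> ?V" "?c \<in> ?V"
    using ij unfolding F_nodes by (blast, blast, force)
  have diag: "X ?a ?a = 1" "X ?b ?b = 1" "X ?c ?c = 1"
    using feas V by (auto simp: sdp_feasible_def)
  have sym: "X ?b ?a = X ?a ?b" "X ?a ?c = X ?c ?a" "X ?b ?c = X ?c ?b"
    using psd V unfolding psd_on_def by blast+
  define m where "m = (\<lambda>x. (unit_at ?a x + 1 * unit_at ?b x) + (- sqrt 2) * unit_at ?c x)"
  have m_B: "?B m f = ?B (unit_at ?a) f + ?B (unit_at ?b) f - sqrt 2 * ?B (unit_at ?c) f" for f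
    unfolding m_def gram_form_add_scaled_left by simp
  have B_m: "?B f m = ?B m f" for f by (rule gram_form_sym[OF psd])
  have m_a: "?B m (unit_at ?a) = 1 + X ?a ?b - sqrt 2 * X ?c ?a"
    and m_b: "?B m (unit_at ?b) = X ?a ?b + 1 - sqrt 2 * X ?c ?b"
    and m_c: "?B m (unit_at ?c) = X ?c ?a + X ?c ?b - sqrt 2"
    unfolding m_B by (simp_all only: gram_form_units[OF fin] V diag sym)
  have "?B m m = ?B m (unit_at ?a) + ?B m (unit_at ?b) - sqrt 2 * ?B m (unit_at ?c)"
    unfolding m_B[of m] by (simp only: B_m[of "unit_at _"])
  also have "\<dots> = 4 - 2 * triangle_value X i j"
    unfolding m_a m_b m_c triangle_value_def by (simp add: algebra_simps)
  finally have mm: "?B m m = 4 - 2 * triangle_value X i j" .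
  show "triangle_value X i j \<le> 2" using gram_form_nonneg[OF psd, of m] mm by simp
  assume eq: "triangle_value X i j = 2"
  then have "?B m f = 0" for f using gram_form_null[OF psd, of m f] mm by simp
  then have "1 + X ?a ?b - sqrt 2 * X ?c ?a = 0" "X ?a ?b + 1 - sqrt 2 * X ?c ?b = 0"
    using m_a m_b by simp_all
  then show "X ?a ?b = 0" using eq unfolding triangle_value_def by linarith
qed

text \<open>The clique nodes become the standard basis of $\mathbb{R}^r$, and an apex the normalised
  sum of its two neighbours. The summand is written \<open>1 * unit_at j x\<close> to have the shape of
  the linearity rules for \<open>gram_form\<close>.\<close>

definition F_vector :: "fnode \<Rightarrow> nat \<Rightarrow> real" where
  "F_vector u = (case u of Vert i \<Rightarrow> unit_at i
     | Apex i j \<Rightarrow> (\<lambda>x. (1 / sqrt 2) * (unit_at i x + 1 * unit_at j x)))"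

lemma F_weight_attained:
  obtains Y where "sdp_feasible (F_graph r) Y"
    "\<And>i j. (i, j) \<in> node_pairs r \<Longrightarrow> triangle_value Y i j = 2"
proof -
  let ?I = "\<lambda>i j :: nat. if i = j then 1 else (0 :: real)"
  define R where "R = {1..r}"
  let ?B = "gram_form R ?I"
  define Y where "Y = (\<lambda>u v. ?B (F_vector u) (F_vector v))"
  have psd: "psd_on R ?I" by (rule psd_on_unit_gram) (simp add: R_def)
  have units: "?B (unit_at i) (unit_at j) = ?I i j" if "i \<in> R" "j \<in> R" for i j
    using that by (intro gram_form_units) (auto simp: R_def)
  have apex: "?B (F_vector (Apex i j)) f = (?B (unit_at i) f + ?B (unit_at j) f) / sqrt 2"
     "?B f (F_vector (Apex i j)) = (?B f (unit_at i) + ?B f (unit_at j)) / sqrt 2" for i j f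
    unfolding F_vector_def fnode.case gram_form_scaled_left gram_form_add_scaled_left
      gram_form_scaled_right[OF psd] gram_form_add_scaled_right[OF psd] by simp_all
  have vert: "F_vector (Vert i) = unit_at i" for i by (simp add: F_vector_def)
  have "Y u u = 1" if u: "u \<in> fst (F_graph r)" for u
  proof -
    consider i where "u = Vert i" "i \<in> R" | i j where "u = Apex i j" "(i, j) \<in> node_pairs r"
      using u by (auto simp: F_nodes R_def)
    then show ?thesis
    proof cases
      case 1
      then show ?thesis by (simp add: Y_def vert units)
    next
      case 2
      then have ij: "i \<in> R" "j \<in> R" "i \<noteq> j" by (auto simp: node_pairs_def R_def)
      show ?thesis unfolding 2(1) Y_def apex using ij by (simp add: units)
    qed
  qed
  moreover have "psd_on (fst (F_graph r)) Y"
    unfolding Y_def using simple_graph_F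
    by (intro psd_on_gram_matrix[OF psd]) (simp add: simple_graph_def)
  ultimately have "sdp_feasible (F_graph r) Y" by (simp add: sdp_feasible_def)
  moreover have "triangle_value Y i j = 2" if "(i, j) \<in> node_pairs r" for i j
  proof -
    have ij: "i \<in> R" "j \<in> R" "i \<noteq> j" using that by (auto simp: node_pairs_def R_def)
    show ?thesis unfolding triangle_value_def Y_def apex vert using ij by (simp add: units)
  qed
  ultimately show ?thesis by (rule that)
qed

lemma rank_on_F_optimal_ge:
  assumes opt: "sdp_optimal (F_graph r) F_weight X"
  shows "r \<le> rank_on (fst (F_graph r)) X"
proof -
  have feas: "sdp_feasible (F_graph r) X" using opt by (simp add: sdp_optimal_def)
  obtain Y where Y: "sdp_feasible (F_graph r) Y"
      "\<And>i j. (i, j) \<in> node_pairs r \<Longrightarrow> triangle_value Y i j = 2"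
    by (rule F_weight_attained[of r]) blast
  have "(\<Sum>(i, j)\<in>node_pairs r. triangle_value Y i j) \<le> (\<Sum>(i, j)\<in>node_pairs r. triangle_value X i j)"
    using opt Y(1) by (simp add: sdp_optimal_def sdp_objective_F[symmetric])
  moreover have "(\<Sum>(i, j)\<in>node_pairs r. triangle_value Y i j) = (\<Sum>p\<in>node_pairs r. 2)"
    using Y(2) by (intro sum.cong) auto
  ultimately have "(\<Sum>(i, j)\<in>node_pairs r. 2 - triangle_value X i j) \<le> 0"
    by (simp add: sum_subtractf case_prod_beta)
  moreover have nonneg: "0 \<le> (case p of (i, j) \<Rightarrow> 2 - triangle_value X i j)"
    if "p \<in> node_pairs r" for p
    using triangle_value_le(1)[OF feas, of "fst p" "snd p"] that by (simp add: case_prod_beta)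
  ultimately have sum0: "(\<Sum>(i, j)\<in>node_pairs r. 2 - triangle_value X i j) = 0"
    by (intro antisym sum_nonneg) auto
  have orth: "X (Vert i) (Vert j) = 0" if ij: "(i, j) \<in> node_pairs r" for i j
    using triangle_value_le(2)[OF feas ij] sum_nonneg_0[OF finite_node_pairs nonneg sum0 ij] by simp
  have fin: "finite (fst (F_graph r))" using simple_graph_F by (simp add: simple_graph_def)
  have "card (core r) \<le> rank_on (fst (F_graph r)) X"
  proof (rule rank_on_ge_orthonormal[OF fin])
    show "core r \<subseteq> fst (F_graph r)" by (simp add: F_nodes)
    fix u v assume uv: "u \<in> core r" "v \<in> core r"
    then obtain i j where ij: "u = Vert i" "v = Vert j" "i \<in> {1..r}" "j \<in> {1..r}" by blast
    have V: "u \<in> fst (F_graph r)" "v \<in> fst (F_graph r)" using uv by (auto simp: F_nodes)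
    have sym: "X u v = X v u" and diag: "X u u = 1"
      using feas V by (auto simp: sdp_feasible_def psd_on_def)
    consider "i = j" | "(i, j) \<in> node_pairs r" | "(j, i) \<in> node_pairs r"
      using ij linorder_less_linear[of i j] by (auto simp: node_pairs_def)
    then show "X u v = (if u = v then 1 else 0)"
    proof cases
      case 2
      then show ?thesis using orth[OF 2] ij(1,2) by (simp add: node_pairs_def)
    next
      case 3
      then show ?thesis using orth[OF 3] ij(1,2) sym by (simp add: node_pairs_def)
    qed (use ij diag in simp)
  qed
  then show ?thesis by (simp only: card_core)
qed

lemma egd_attained:
  assumes "finite (fst G)" "vertex_cover G C" "C \<noteq> {}"
  shows "\<exists>X. sdp_optimal G w X \<and> rank_on (fst G) X \<le> egd G"
proof -
  have "finite C" using assms(1,2) finite_subset by (auto simp: vertex_cover_def)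
  then have "card C \<ge> 1" using assms(3) by (simp add: Suc_le_eq card_gt_0_iff)
  define P where "P = (\<lambda>r. r \<ge> 1 \<and> (\<forall>w. \<exists>X. sdp_optimal G w X \<and> rank_on (fst G) X \<le> r))"
  have "P (card C)"
    unfolding P_def using \<open>card C \<ge> 1\<close> low_rank_optimum_of_cover[OF assms] by simp
  then have "P (LEAST r. P r)" by (rule LeastI)
  moreover have "(LEAST r. P r) = egd G" by (simp only: P_def egd_def)
  ultimately show ?thesis by (simp add: P_def)
qed

theorem theorem4p2:
  fixes r :: nat
  assumes "r \<ge> 2"
  shows "egd (F_graph r) = r \<and> minimal_forbidden_minor (F_graph r) (egd_class (r - 1))"
proof -
  have fin: "finite (fst (F_graph r))" using simple_graph_F by (simp add: simple_graph_def)
  have le: "egd (F_graph r) \<le> r"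
    using egd_le_card_vertex_cover[OF fin vertex_cover_F, of r] assms
    unfolding card_core by simp
  have "core r \<noteq> {}" using assms by simp
  then obtain X where X: "sdp_optimal (F_graph r) F_weight X"
      "rank_on (fst (F_graph r)) X \<le> egd (F_graph r)"
    using egd_attained[OF fin vertex_cover_F] by blast
  have "r \<le> egd (F_graph r)" by (rule order_trans[OF rank_on_F_optimal_ge[OF X(1)] X(2)])
  with le have egd: "egd (F_graph r) = r" by simp
  have "H \<in> egd_class (r - 1)" if "proper_minor H (F_graph r)" for H
    using low_cover_F_proper_minor[OF assms that] egd_le_of_low_cover[of "r - 1" H] assms
    by (simp add: egd_class_def low_cover_def)
  moreover have "F_graph r \<notin> egd_class (r - 1)" 
  proof
    assume "F_graph r \<in> egd_class (r - 1)"
    then have "egd (F_graph r) \<le> r - 1" by (simp add: egd_class_def)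
    then show False using egd assms by linarith
  qed
  ultimately show ?thesis
    using egd simple_graph_F by (simp add: minimal_forbidden_minor_def)
qed

end
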